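(* Let $\mathsf M$ be a matroid on $[n]$ that is realizable over $\mathbb C$ and $\Bbbk$ a field. Then $\mathcal R^p(\mathsf M)\subseteq \mathcal B^p(\mathsf M)$ for all $p\ge0$.
   Context: $\mathsf M$ complex-realizable means there are nonzero linear forms $f_1,\dots,f_n$ on a complex vector space such that a subset $S\subseteq[n]$ is dependent in $\mathsf M$ iff the forms $(f_i)_{i\in S}$ are linearly dependent (repetitions allowed). Let $V=\Bbbk^n$ with basis $e_1,\dots,e_n$, $E=\Lambda(V)$, $\partial$ the graded derivation with $\partial(e_i)=1$, $e_C=\prod_{i\in C}e_i$; $A(\mathsf M)=E/I$ with $I$ generated by $\partial(e_C)$ over circuits $C$; $\mathcal R^p(\mathsf M)=\{v\in V:H^p(A(\mathsf M),\cdot v)\ne0\}$, where $(A(\mathsf M),\cdot v)$ has differential $x\mapsto xv$. Let $\overline V=\{v:\sum v_i=0\}$. $L^{\mathrm{irr}}_{\le m}(\mathsf M)$ is the set of nonempty flats of rank $\le m$ on which the restriction of $\mathsf M$ is connected. A set $\mathcal C$ of flats covers $\mathsf M$ if there is a surjective function $g\colon[n]\to\mathcal C$ with $i\in g(i)$ for all $i$. For a cover $\mathcal C$, $P_{\mathcal C}=\bigcap_{X\in\mathcal C}\{x\in\overline V:\sum_{i\in X}x_i=0\}$. Then $\mathcal B^p(\mathsf M)=\bigcup_{\mathcal C}P_{\mathcal C}$, the union over all $\mathcal C\subseteq L^{\mathrm{irr}}_{\le p+1}(\mathsf M)$ that cover $\mathsf M$. *)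

theory Defs
  imports Complex_Main "HOL-Algebra.QuotRing"
begin

section \<open>Matroids\<close>

locale matroid =
  fixes ground :: "'a set" and indep :: "'a set \<Rightarrow> bool"
  assumes finite_ground: "finite ground"
    and indep_subset_ground: "indep S \<Longrightarrow> S \<subseteq> ground"
    and indep_empty: "indep {}"
    and indep_mono: "indep S \<Longrightarrow> T \<subseteq> S \<Longrightarrow> indep T"
    and augmentation: "indep S \<Longrightarrow> indep T \<Longrightarrow> card S < card T \<Longrightarrow>
                         \<exists>x\<in>T - S. indep (insert x S)"

definition circuit :: "'a set \<Rightarrow> ('a set \<Rightarrow> bool) \<Rightarrow> 'a set \<Rightarrow> bool" where
  "circuit G I C \<longleftrightarrow> C \<subseteq> G \<and> \<not> I C \<and> (\<forall>D. D \<subset> C \<longrightarrow> I D)"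

definition rank_of :: "('a set \<Rightarrow> bool) \<Rightarrow> 'a set \<Rightarrow> nat" where
  "rank_of I X = Max (card ` {S. S \<subseteq> X \<and> I S})"

definition flat :: "'a set \<Rightarrow> ('a set \<Rightarrow> bool) \<Rightarrow> 'a set \<Rightarrow> bool" where
  "flat G I X \<longleftrightarrow> X \<subseteq> G \<and> (\<forall>x\<in>G - X. rank_of I (insert x X) > rank_of I X)"

definition restriction :: "('a set \<Rightarrow> bool) \<Rightarrow> 'a set \<Rightarrow> 'a set \<Rightarrow> bool" where
  "restriction I X = (\<lambda>S. S \<subseteq> X \<and> I S)"

definition connected_matroid :: "'a set \<Rightarrow> ('a set \<Rightarrow> bool) \<Rightarrow> bool" where
  "connected_matroid G I \<longleftrightarrow>
     (\<forall>x\<in>G. \<forall>y\<in>G. x \<noteq> y \<longrightarrow> (\<exists>C. circuit G I C \<and> x \<in> C \<and> y \<in> C))"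

definition L_irr_le :: "nat \<Rightarrow> 'a set \<Rightarrow> ('a set \<Rightarrow> bool) \<Rightarrow> 'a set set" where
  "L_irr_le m G I =
     {X. flat G I X \<and> X \<noteq> {} \<and> rank_of I X \<le> m \<and> connected_matroid X (restriction I X)}"

text \<open>
  Linear dependence of the family \<open>(f i)\<^sub>i\<close> over \<open>S\<close>, not of the set \<open>f ` S\<close>: if \<open>f i = f j\<close> with
  \<open>i \<noteq> j\<close> then \<open>{i, j}\<close> is dependent.
\<close>

definition linearly_dependent_family :: "('a \<Rightarrow> 'w \<Rightarrow> complex) \<Rightarrow> 'a set \<Rightarrow> bool" where
  "linearly_dependent_family f S \<longleftrightarrow>
     (\<exists>c :: 'a \<Rightarrow> complex. (\<exists>i\<in>S. c i \<noteq> 0) \<and> (\<forall>w. (\<Sum>i\<in>S. c i * f i w) = 0))"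

text \<open>
  The complex vector space is the type \<open>'w\<close> with scalar multiplication \<open>scale\<close>. Since HOL cannot
  quantify existentially over types, these are parameters of the predicate.
\<close>

definition complex_realizable ::
  "(complex \<Rightarrow> 'w \<Rightarrow> 'w::ab_group_add) \<Rightarrow> 'a set \<Rightarrow> ('a set \<Rightarrow> bool) \<Rightarrow> bool" where
  "complex_realizable scale G I \<longleftrightarrow>
     vector_space scale \<and>
     (\<exists>f :: 'a \<Rightarrow> 'w \<Rightarrow> complex.
        (\<forall>i\<in>G. Vector_Spaces.linear scale (*) (f i) \<and> (\<exists>w. f i w \<noteq> 0)) \<and>
        (\<forall>S\<subseteq>G. \<not> I S \<longleftrightarrow> linearly_dependent_family f S))"


section \<open>The exterior algebra\<close>

text \<open>
  \<open>G\<close> is the finite index set of a basis \<open>(e\<^sub>i)\<close> of \<open>V\<close>. An element of \<open>\<Lambda>(V)\<close> is the function sending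
  \<open>S \<subseteq> G\<close> to its coefficient at \<open>e\<^sub>S\<close>, the product of the \<open>e\<^sub>i\<close>, \<open>i \<in> S\<close>, in increasing order; it is \<open>0\<close>
  on all other sets. For disjoint \<open>S\<close>, \<open>T\<close> one has \<open>e\<^sub>S e\<^sub>T = ext_sign S T e\<^bsub>S \<union> T\<^esub>\<close>, the exponent being
  the number of transpositions needed to sort the concatenation.
\<close>

definition V_space :: "'i set \<Rightarrow> ('i \<Rightarrow> 'k::field) set" where
  "V_space G = {v. \<forall>i. i \<notin> G \<longrightarrow> v i = 0}"

definition V_bar :: "'i set \<Rightarrow> ('i \<Rightarrow> 'k::field) set" where
  "V_bar G = {v \<in> V_space G. (\<Sum>i\<in>G. v i) = 0}"

definition ext_sign :: "'i::linorder set \<Rightarrow> 'i set \<Rightarrow> 'k::field" where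
  "ext_sign S T = (- 1) ^ card {(s, t). s \<in> S \<and> t \<in> T \<and> t < s}"

definition ext_basis :: "'i set \<Rightarrow> 'i set \<Rightarrow> 'k::field" where
  "ext_basis S = (\<lambda>T. if T = S then 1 else 0)"

definition ext_mult ::
  "('i::linorder set \<Rightarrow> 'k::field) \<Rightarrow> ('i set \<Rightarrow> 'k) \<Rightarrow> 'i set \<Rightarrow> 'k" where
  "ext_mult x y = (\<lambda>U. \<Sum>S\<in>Pow U. ext_sign S (U - S) * x S * y (U - S))"

definition ext_alg :: "'i::linorder set \<Rightarrow> ('i set \<Rightarrow> 'k::field) ring" where
  "ext_alg G =
     \<lparr>carrier = {x. \<forall>S. x S \<noteq> 0 \<longrightarrow> S \<subseteq> G},
      monoid.mult = ext_mult,
      one = ext_basis {},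
      ring.zero = (\<lambda>S. 0),
      add = (\<lambda>x y S. x S + y S)\<rparr>"

definition ext_degree :: "'i::linorder set \<Rightarrow> nat \<Rightarrow> ('i set \<Rightarrow> 'k::field) set" where
  "ext_degree G p = {x \<in> carrier (ext_alg G). \<forall>S. x S \<noteq> 0 \<longrightarrow> card S = p}"

definition ext_vec :: "'i set \<Rightarrow> ('i \<Rightarrow> 'k::field) \<Rightarrow> 'i set \<Rightarrow> 'k" where
  "ext_vec G v = (\<lambda>S. \<Sum>i\<in>G. v i * ext_basis {i} S)"

text \<open>
  \<open>\<partial>(e\<^sub>T) = \<Sum>i\<in>T. (-1)^card {j \<in> T. j < i} e\<^bsub>T - {i}\<^esub>\<close>, read off at the coefficient of \<open>e\<^sub>S\<close>, \<open>S = T - {i}\<close>.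
  Below this is shown to be the graded derivation with \<open>\<partial>(e\<^sub>i) = 1\<close>.
\<close>

definition ext_deriv ::
  "'i::linorder set \<Rightarrow> ('i set \<Rightarrow> 'k::field) \<Rightarrow> 'i set \<Rightarrow> 'k" where
  "ext_deriv G x = (\<lambda>S. \<Sum>i\<in>G - S. (- 1) ^ card {j \<in> S. j < i} * x (insert i S))"


section \<open>The Orlik-Solomon algebra and resonance\<close>

definition OS_ideal :: "'i::linorder set \<Rightarrow> ('i set \<Rightarrow> bool) \<Rightarrow> ('i set \<Rightarrow> 'k::field) set" where
  "OS_ideal G I = Idl\<^bsub>ext_alg G\<^esub> {ext_deriv G (ext_basis C) | C. circuit G I C}"

definition OS_alg :: "'i::linorder set \<Rightarrow> ('i set \<Rightarrow> bool) \<Rightarrow> ('i set \<Rightarrow> 'k::field) set ring" where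
  "OS_alg G I = ext_alg G Quot OS_ideal G I"

definition OS_class ::
  "'i::linorder set \<Rightarrow> ('i set \<Rightarrow> bool) \<Rightarrow> ('i set \<Rightarrow> 'k::field) \<Rightarrow> ('i set \<Rightarrow> 'k) set" where
  "OS_class G I x = OS_ideal G I +>\<^bsub>ext_alg G\<^esub> x"

definition OS_degree ::
  "'i::linorder set \<Rightarrow> ('i set \<Rightarrow> bool) \<Rightarrow> nat \<Rightarrow> ('i set \<Rightarrow> 'k::field) set set" where
  "OS_degree G I p = OS_class G I ` ext_degree G p"

definition OS_diff ::
  "'i::linorder set \<Rightarrow> ('i set \<Rightarrow> bool) \<Rightarrow> ('i \<Rightarrow> 'k::field) \<Rightarrow>
   ('i set \<Rightarrow> 'k) set \<Rightarrow> ('i set \<Rightarrow> 'k) set" where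
  "OS_diff G I v x = x \<otimes>\<^bsub>OS_alg G I\<^esub> OS_class G I (ext_vec G v)"

definition OS_cocycles ::
  "'i::linorder set \<Rightarrow> ('i set \<Rightarrow> bool) \<Rightarrow> ('i \<Rightarrow> 'k::field) \<Rightarrow> nat \<Rightarrow> ('i set \<Rightarrow> 'k) set set" where
  "OS_cocycles G I v p = {x \<in> OS_degree G I p. OS_diff G I v x = \<zero>\<^bsub>OS_alg G I\<^esub>}"

definition OS_coboundaries ::
  "'i::linorder set \<Rightarrow> ('i set \<Rightarrow> bool) \<Rightarrow> ('i \<Rightarrow> 'k::field) \<Rightarrow> nat \<Rightarrow> ('i set \<Rightarrow> 'k) set set" where
  "OS_coboundaries G I v p =
     (case p of 0 \<Rightarrow> {\<zero>\<^bsub>OS_alg G I\<^esub>} | Suc q \<Rightarrow> OS_diff G I v ` OS_degree G I q)"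

text \<open>
  Cocycles modulo coboundaries as a quotient of additive groups; the scalar structure, which plays no
  part in whether the cohomology vanishes, is forgotten.
\<close>

definition OS_cohomology ::
  "'i::linorder set \<Rightarrow> ('i set \<Rightarrow> bool) \<Rightarrow> ('i \<Rightarrow> 'k::field) \<Rightarrow> nat \<Rightarrow>
   ('i set \<Rightarrow> 'k) set set monoid" where
  "OS_cohomology G I v p =
     (add_monoid (OS_alg G I)\<lparr>carrier := OS_cocycles G I v p\<rparr>) Mod OS_coboundaries G I v p"

definition resonance :: "nat \<Rightarrow> 'i::linorder set \<Rightarrow> ('i set \<Rightarrow> bool) \<Rightarrow> ('i \<Rightarrow> 'k::field) set" where
  "resonance p G I =
     {v \<in> V_space G. carrier (OS_cohomology G I v p) \<noteq> {\<one>\<^bsub>OS_cohomology G I v p\<^esub>}}"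


section \<open>Covers\<close>

definition covers :: "'i set \<Rightarrow> 'i set set \<Rightarrow> bool" where
  "covers G \<C> \<longleftrightarrow> (\<exists>g. g ` G = \<C> \<and> (\<forall>i\<in>G. i \<in> g i))"

definition P_cover :: "'i set \<Rightarrow> 'i set set \<Rightarrow> ('i \<Rightarrow> 'k::field) set" where
  "P_cover G \<C> = {x \<in> V_bar G. \<forall>X\<in>\<C>. (\<Sum>i\<in>X. x i) = 0}"

definition B_set :: "nat \<Rightarrow> 'i set \<Rightarrow> ('i set \<Rightarrow> bool) \<Rightarrow> ('i \<Rightarrow> 'k::field) set" where
  "B_set p G I = \<Union> {P_cover G \<C> | \<C>. \<C> \<subseteq> L_irr_le (p + 1) G I \<and> covers G \<C>}"


section \<open>The exterior algebra is a ring and \<open>ext_deriv\<close> its derivation\<close>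

lemma ext_sign_Un_left:
  assumes "finite A" "finite B" "finite D" "A \<inter> B = {}"
  shows "ext_sign (A \<union> B) D = (ext_sign A D * ext_sign B D :: 'k::field)"
proof -
  have "{(s, t). s \<in> A \<union> B \<and> t \<in> D \<and> t < s} =
        {(s, t). s \<in> A \<and> t \<in> D \<and> t < s} \<union> {(s, t). s \<in> B \<and> t \<in> D \<and> t < s}" by auto
  moreover have "finite {(s, t). s \<in> A \<and> t \<in> D \<and> t < s}"
    by (rule finite_subset[of _ "A \<times> D"]) (use assms in auto)
  moreover have "finite {(s, t). s \<in> B \<and> t \<in> D \<and> t < s}"
    by (rule finite_subset[of _ "B \<times> D"]) (use assms in auto)
  ultimately show ?thesis
    unfolding ext_sign_def power_add[symmetric] using assms(4)
    by (subst card_Un_disjoint[symmetric]) auto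
qed

lemma ext_sign_Un_right:
  assumes "finite A" "finite B" "finite D" "A \<inter> B = {}"
  shows "ext_sign D (A \<union> B) = (ext_sign D A * ext_sign D B :: 'k::field)"
proof -
  have "{(s, t). s \<in> D \<and> t \<in> A \<union> B \<and> t < s} =
        {(s, t). s \<in> D \<and> t \<in> A \<and> t < s} \<union> {(s, t). s \<in> D \<and> t \<in> B \<and> t < s}" by auto
  moreover have "finite {(s, t). s \<in> D \<and> t \<in> A \<and> t < s}"
    by (rule finite_subset[of _ "D \<times> A"]) (use assms in auto)
  moreover have "finite {(s, t). s \<in> D \<and> t \<in> B \<and> t < s}"
    by (rule finite_subset[of _ "D \<times> B"]) (use assms in auto)
  ultimately show ?thesis
    unfolding ext_sign_def power_add[symmetric] using assms(4)
    by (subst card_Un_disjoint[symmetric]) auto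
qed

lemma ext_sign_empty [simp]: "ext_sign {} T = 1" "ext_sign S {} = 1"
  by (simp_all add: ext_sign_def)

lemma ext_sign_square: "ext_sign S T * ext_sign S T = (1 :: 'k::field)"
  by (simp add: ext_sign_def flip: power_mult_distrib)

lemma ext_sign_swap:
  assumes "finite A" "i \<notin> A"
  shows "ext_sign {i} A * ext_sign A {i} = ((- 1) ^ card A :: 'k::field)"
proof -
  have "{(s, t). s \<in> {i} \<and> t \<in> A \<and> t < s} = Pair i ` {t \<in> A. t < i}" by auto
  then have 1: "card {(s, t). s \<in> {i} \<and> t \<in> A \<and> t < s} = card {t \<in> A. t < i}"
    by (simp add: card_image inj_on_def)
  have "{(s, t). s \<in> A \<and> t \<in> {i} \<and> t < s} = (\<lambda>s. (s, i)) ` {s \<in> A. i < s}" by auto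
  then have 2: "card {(s, t). s \<in> A \<and> t \<in> {i} \<and> t < s} = card {s \<in> A. i < s}"
    by (simp add: card_image inj_on_def)
  have "A = {t \<in> A. t < i} \<union> {s \<in> A. i < s}" using assms by (auto simp: not_less le_less)
  then have "card A = card {t \<in> A. t < i} + card {s \<in> A. i < s}"
    using assms by (metis (no_types, lifting) card_Un_disjoint disjoint_iff finite_Un
        mem_Collect_eq order_less_asym)
  then show ?thesis unfolding ext_sign_def 1 2 by (simp add: power_add)
qed

lemma ext_sign_singleton: "ext_sign {i} S = (- 1) ^ card {j \<in> S. j < i}"
proof -
  have "{(s, t). s \<in> {i} \<and> t \<in> S \<and> t < s} = Pair i ` {t \<in> S. t < i}" by auto
  then show ?thesis by (simp add: ext_sign_def card_image inj_on_def)
qed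

lemma ext_mult_infinite: "infinite U \<Longrightarrow> ext_mult x y U = 0"
  by (simp add: ext_mult_def)

lemma ext_mult_assoc:
  fixes x y z :: "'i::linorder set \<Rightarrow> 'k::field"
  shows "ext_mult (ext_mult x y) z = ext_mult x (ext_mult y z)"
proof
  fix U :: "'i set"
  show "ext_mult (ext_mult x y) z U = ext_mult x (ext_mult y z) U"
  proof (cases "finite U")
    case True
    have "ext_mult (ext_mult x y) z U =
      (\<Sum>A\<in>Pow U. \<Sum>B\<in>Pow A. ext_sign A (U - A) * (ext_sign B (A - B) * x B * y (A - B)) * z (U - A))"
      by (simp add: ext_mult_def sum_distrib_left sum_distrib_right)
    also have "\<dots> = (\<Sum>(A, B)\<in>(SIGMA A:Pow U. Pow A).
        ext_sign A (U - A) * (ext_sign B (A - B) * x B * y (A - B)) * z (U - A))"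
      by (rule sum.Sigma) (use True in \<open>auto intro: finite_subset\<close>)
    also have "\<dots> = (\<Sum>(B, C)\<in>(SIGMA B:Pow U. Pow (U - B)).
        ext_sign B (U - B) * x B * (ext_sign C (U - B - C) * y C * z (U - B - C)))"
    proof (rule sum.reindex_bij_witness[where j = "\<lambda>(A, B). (B, A - B)" and i = "\<lambda>(B, C). (B \<union> C, B)"],
        goal_cases)
      case (5 a)
      obtain A B where a: "a = (A, B)" by (cases a)
      define C where "C = A - B"
      define D where "D = U - A"
      have *: "A = B \<union> C" "U - B = C \<union> D" "B \<inter> C = {}" "C \<inter> D = {}" "finite B" "finite C" "finite D"
        "U - B - C = D" "U - A = D"
        using 5 True unfolding a C_def D_def by (auto intro: finite_subset)
      have "(ext_sign A D * ext_sign B C :: 'k) = ext_sign B (U - B) * ext_sign C D"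
        unfolding *(1,2) using *(3-7)
        by (simp add: ext_sign_Un_left ext_sign_Un_right Int_Un_distrib Int_commute mult_ac)
      then have "(ext_sign A D * ext_sign B C) * (x B * y C * z D) =
          (ext_sign B (U - B) * ext_sign C D) * (x B * y C * z D)" by simp
      then show ?case unfolding a prod.case C_def[symmetric] *(8,9) by (simp only: mult_ac)
    qed auto
    also have "\<dots> = (\<Sum>B\<in>Pow U. \<Sum>C\<in>Pow (U - B).
        ext_sign B (U - B) * x B * (ext_sign C (U - B - C) * y C * z (U - B - C)))"
      by (rule sum.Sigma[symmetric]) (use True in auto)
    also have "\<dots> = ext_mult x (ext_mult y z) U"
      by (simp add: ext_mult_def sum_distrib_left)
    finally show ?thesis .
  qed (simp add: ext_mult_infinite)
qed

lemma ext_basis_mult: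
  assumes "finite S" "finite T"
  shows "ext_mult (ext_basis S) (ext_basis T) =
    (\<lambda>U. if S \<inter> T = {} then ext_sign S T * ext_basis (S \<union> T) U else (0 :: 'k::field))"
proof
  fix U :: "'a set"
  have eq: "ext_mult (ext_basis S) (ext_basis T) U =
      (\<Sum>A\<in>Pow U. if A = S then (if U - S = T then ext_sign S T else (0 :: 'k)) else 0)"
    unfolding ext_mult_def ext_basis_def by (rule sum.cong) auto
  show "ext_mult (ext_basis S) (ext_basis T) U =
      (if S \<inter> T = {} then ext_sign S T * ext_basis (S \<union> T) U else (0 :: 'k))"
  proof (cases "finite U")
    case True
    then show ?thesis unfolding eq by (auto simp: ext_basis_def)
  next
    case False
    then show ?thesis using assms by (auto simp: ext_mult_infinite ext_basis_def)
  qed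
qed

lemma ext_mult_one_left:
  assumes "\<And>U. infinite U \<Longrightarrow> x U = 0"
  shows "ext_mult (ext_basis {}) x = (x :: _ \<Rightarrow> 'k::field)"
proof
  fix U :: "'a set"
  have "ext_mult (ext_basis {}) x U = (\<Sum>A\<in>Pow U. if A = {} then x U else 0)"
    unfolding ext_mult_def ext_basis_def by (rule sum.cong) auto
  then show "ext_mult (ext_basis {}) x U = x U"
    using assms[of U] by (cases "finite U") (simp_all add: ext_mult_infinite)
qed

lemma ext_mult_one_right:
  assumes "\<And>U. infinite U \<Longrightarrow> x U = 0"
  shows "ext_mult x (ext_basis {}) = (x :: _ \<Rightarrow> 'k::field)"
proof
  fix U :: "'a set"
  have "ext_mult x (ext_basis {}) U = (\<Sum>A\<in>Pow U. if A = U then x U else 0)"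
    unfolding ext_mult_def ext_basis_def by (rule sum.cong) auto
  then show "ext_mult x (ext_basis {}) U = x U"
    using assms[of U] by (cases "finite U") (simp_all add: ext_mult_infinite)
qed

lemma ext_alg_ring:
  assumes "finite G"
  shows "ring (ext_alg G :: ('i::linorder set \<Rightarrow> 'k::field) ring)"
proof (rule ringI)
  show "abelian_group (ext_alg G :: ('i set \<Rightarrow> 'k) ring)"
  proof (rule abelian_groupI)
    fix x :: "'i set \<Rightarrow> 'k" assume x: "x \<in> carrier (ext_alg G)"
    show "\<exists>y\<in>carrier (ext_alg G). y \<oplus>\<^bsub>ext_alg G\<^esub> x = \<zero>\<^bsub>ext_alg G\<^esub>"
      by (rule bexI[of _ "\<lambda>S. - x S"]) (use x in \<open>auto simp: ext_alg_def\<close>)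
  next
    fix x y :: "'i set \<Rightarrow> 'k"
    assume x: "x \<in> carrier (ext_alg G)" and y: "y \<in> carrier (ext_alg G)"
    show "x \<oplus>\<^bsub>ext_alg G\<^esub> y \<in> carrier (ext_alg G)"
      using x y unfolding ext_alg_def by simp (metis add.right_neutral)
  qed (auto simp: ext_alg_def algebra_simps)
  have fin: "x U = 0" if "x \<in> carrier (ext_alg G)" "infinite U" for x :: "'i set \<Rightarrow> 'k" and U
    using that assms finite_subset[of U G] unfolding ext_alg_def by auto
  show "monoid (ext_alg G :: ('i set \<Rightarrow> 'k) ring)"
  proof (rule monoidI)
    fix x y :: "'i set \<Rightarrow> 'k"
    assume x: "x \<in> carrier (ext_alg G)" and y: "y \<in> carrier (ext_alg G)"
    have "S \<subseteq> G" if "ext_mult x y S \<noteq> 0" for S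
    proof -
      from that obtain A where "A \<subseteq> S" "ext_sign A (S - A) * x A * y (S - A) \<noteq> 0"
        unfolding ext_mult_def by (meson PowD sum.not_neutral_contains_not_neutral)
      then have "A \<subseteq> G" "S - A \<subseteq> G" using x y by (auto simp: ext_alg_def)
      then show ?thesis by auto
    qed
    then show "x \<otimes>\<^bsub>ext_alg G\<^esub> y \<in> carrier (ext_alg G)" by (auto simp: ext_alg_def)
  next
    show "\<one>\<^bsub>ext_alg G\<^esub> \<in> carrier (ext_alg G :: ('i set \<Rightarrow> 'k) ring)"
      by (auto simp: ext_alg_def ext_basis_def)
  next
    fix x :: "'i set \<Rightarrow> 'k" assume x: "x \<in> carrier (ext_alg G)"
    show "\<one>\<^bsub>ext_alg G\<^esub> \<otimes>\<^bsub>ext_alg G\<^esub> x = x"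
      using ext_mult_one_left[of x] fin[OF x] by (simp add: ext_alg_def)
    show "x \<otimes>\<^bsub>ext_alg G\<^esub> \<one>\<^bsub>ext_alg G\<^esub> = x"
      using ext_mult_one_right[of x] fin[OF x] by (simp add: ext_alg_def)
  qed (simp add: ext_alg_def ext_mult_assoc)
qed (auto simp: ext_alg_def ext_mult_def algebra_simps sum.distrib)

lemma ext_vec_square: "finite G \<Longrightarrow> ext_mult (ext_vec G v) (ext_vec G v) = (\<lambda>_. 0 :: 'k::field)"
proof -
  assume "finite G"
  have sing: "ext_vec G v {i} = (if i \<in> G then v i else 0)" for i
  proof -
    have "ext_vec G v {i} = (\<Sum>j\<in>G. if j = i then v j else 0)"
      unfolding ext_vec_def ext_basis_def by (rule sum.cong) auto
    then show ?thesis using \<open>finite G\<close> by simp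
  qed
  have nsing: "ext_vec G v S = 0" if "\<And>i. S \<noteq> {i}" for S
    using that by (simp add: ext_vec_def ext_basis_def)
  show ?thesis
  proof
    fix U :: "'a set"
    show "ext_mult (ext_vec G v) (ext_vec G v) U = (0 :: 'k)"
    proof (cases "\<exists>a b. a < b \<and> U = {a, b}")
      case True
      then obtain a b where ab: "a < b" "U = {a, b}" by blast
      have P: "Pow U = {{}, {a}, {b}, {a, b}}" using ab by auto
      have D: "{a, b} - {a} = {b}" "{a, b} - {b} = {a}" using ab by auto
      have e: "{j \<in> {b}. j < a} = {}" "{j \<in> {a}. j < b} = {a}" using ab by auto
      have s: "ext_sign {a} {b} = (1 :: 'k)" "ext_sign {b} {a} = (- 1 :: 'k)"
        unfolding ext_sign_singleton e by simp_all
      have "{} \<noteq> {a, b}" "{a} \<noteq> {a, b}" "{b} \<noteq> {a, b}" "{a} \<noteq> {b}" "{b} \<noteq> {a}" using ab by auto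
      then have Q: "(\<Sum>S\<in>{{}, {a}, {b}, {a, b}}. h S) = h {} + h {a} + h {b} + h {a, b}"
        for h :: "'a set \<Rightarrow> 'k" by (simp add: add.assoc)
      have "ext_vec G v {} = (0 :: 'k)" by (rule nsing) simp
      then show ?thesis
        unfolding ext_mult_def ab(2) P[unfolded ab(2)] Q D s sing by simp
    next
      case False
      have "ext_sign S (U - S) * ext_vec G v S * ext_vec G v (U - S) = (0 :: 'k)" if "S \<in> Pow U" for S
      proof (rule ccontr)
        assume "\<not> ?thesis"
        then obtain a b where "S = {a}" "U - S = {b}" using nsing by (metis mult_zero_left mult_zero_right)
        then have "a \<noteq> b" "U = {a, b}" using that by auto
        then show False using False by (metis insert_commute linorder_neqE)
      qed
      then show ?thesis unfolding ext_mult_def by (simp add: sum.neutral)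
    qed
  qed
qed

text \<open>The contraction against \<open>e\<^sub>i\<close>; \<open>ext_deriv G\<close> is the sum of these over \<open>i \<in> G\<close>.\<close>

definition ext_contract :: "'i::linorder \<Rightarrow> ('i set \<Rightarrow> 'k::field) \<Rightarrow> 'i set \<Rightarrow> 'k" where
  "ext_contract i x = (\<lambda>S. if i \<in> S then 0 else ext_sign {i} S * x (insert i S))"

lemma ext_deriv_contract:
  "finite G \<Longrightarrow> ext_deriv G x S = (\<Sum>i\<in>G. ext_contract i x S)"
proof -
  assume "finite G"
  then have "(\<Sum>i\<in>G. ext_contract i x S) = (\<Sum>i\<in>G - S. ext_contract i x S)"
    by (intro sum.mono_neutral_right) (auto simp: ext_contract_def)
  then show ?thesis by (simp add: ext_deriv_def ext_contract_def ext_sign_singleton)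
qed

lemma ext_contract_mult:
  fixes x y :: "'i::linorder set \<Rightarrow> 'k::field"
  shows "ext_contract i (ext_mult x y) U =
     ext_mult (ext_contract i x) y U
     + ext_mult (\<lambda>S. (- 1) ^ card S * x S) (ext_contract i y) U"
proof (cases "finite U")
  case False
  then show ?thesis by (simp add: ext_contract_def ext_mult_infinite)
next
  case fU: True
  let ?s = "ext_sign :: 'i set \<Rightarrow> 'i set \<Rightarrow> 'k"
  have fin: "finite A" if "A \<subseteq> U" for A using that fU finite_subset by blast
  show ?thesis
  proof (cases "i \<in> U")
    case False
    have Pow: "Pow (insert i U) = Pow U \<union> insert i ` Pow U" by (rule Pow_insert)
    have "ext_contract i (ext_mult x y) U =
       ?s {i} U * (\<Sum>A\<in>Pow U \<union> insert i ` Pow U. ?s A (insert i U - A) * x A * y (insert i U - A))"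
      using False by (simp add: ext_contract_def ext_mult_def Pow)
    also have "\<dots> = ?s {i} U * (\<Sum>A\<in>Pow U. ?s A (insert i U - A) * x A * y (insert i U - A))
       + ?s {i} U * (\<Sum>A\<in>insert i ` Pow U. ?s A (insert i U - A) * x A * y (insert i U - A))"
      using False fU by (subst sum.union_disjoint) (auto simp: algebra_simps)
    also have "(\<Sum>A\<in>insert i ` Pow U. ?s A (insert i U - A) * x A * y (insert i U - A))
       = (\<Sum>A\<in>Pow U. ?s (insert i A) (U - A) * x (insert i A) * y (U - A))"
    proof (subst sum.reindex)
      show "inj_on (insert i) (Pow U)" using False by (auto simp: inj_on_def)
      show "sum ((\<lambda>A. ?s A (insert i U - A) * x A * y (insert i U - A)) \<circ> insert i) (Pow U) =
        (\<Sum>A\<in>Pow U. ?s (insert i A) (U - A) * x (insert i A) * y (U - A))"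
      proof (rule sum.cong)
        fix A assume "A \<in> Pow U"
        have "insert i U - insert i A = U - A" using False by auto
        then show "((\<lambda>A. ?s A (insert i U - A) * x A * y (insert i U - A)) \<circ> insert i) A =
          ?s (insert i A) (U - A) * x (insert i A) * y (U - A)" by simp
      qed simp
    qed
    also have "?s {i} U * \<dots> = ext_mult (ext_contract i x) y U"
      unfolding ext_mult_def sum_distrib_left
    proof (rule sum.cong)
      fix A assume A: "A \<in> Pow U"
      have "?s {i} U = ?s {i} A * ?s {i} (U - A)"
        using A fin fU ext_sign_Un_right[of A "U - A" "{i}"] by (auto simp: Un_absorb1)
      moreover have "?s (insert i A) (U - A) = ?s {i} (U - A) * ?s A (U - A)"
        using A fin fU False ext_sign_Un_left[of "{i}" A "U - A"] by auto
      ultimately have "?s {i} U * ?s (insert i A) (U - A) = ?s {i} A * ?s A (U - A)"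
        using ext_sign_square[of "{i}" "U - A", where 'k = 'k] by (simp add: mult_ac)
      moreover have "i \<notin> A" using A False by auto
      ultimately show "?s {i} U * (?s (insert i A) (U - A) * x (insert i A) * y (U - A)) =
         ?s A (U - A) * ext_contract i x A * y (U - A)"
        by (simp add: ext_contract_def flip: mult.assoc)
    qed simp
    also have "?s {i} U * (\<Sum>A\<in>Pow U. ?s A (insert i U - A) * x A * y (insert i U - A)) =
       ext_mult (\<lambda>S. (- 1) ^ card S * x S) (ext_contract i y) U"
      unfolding ext_mult_def sum_distrib_left
    proof (rule sum.cong)
      fix A assume A: "A \<in> Pow U"
      then have iA: "i \<notin> A" "i \<notin> U - A" "insert i U - A = insert i (U - A)" using False by auto
      have "?s {i} U = ?s {i} A * ?s {i} (U - A)"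
        using A fin fU ext_sign_Un_right[of A "U - A" "{i}"] by (auto simp: Un_absorb1)
      moreover have "?s A (insert i (U - A)) = ?s A {i} * ?s A (U - A)"
        using A fin fU iA ext_sign_Un_right[of "{i}" "U - A" A] by auto
      ultimately have "?s {i} U * ?s A (insert i (U - A)) =
          (?s {i} A * ?s A {i}) * ?s {i} (U - A) * ?s A (U - A)" by (simp add: mult_ac)
      also have "\<dots> = (- 1) ^ card A * ?s {i} (U - A) * ?s A (U - A)"
        using A iA fin by (simp add: ext_sign_swap)
      finally show "?s {i} U * (?s A (insert i U - A) * x A * y (insert i U - A)) =
         ?s A (U - A) * ((- 1) ^ card A * x A) * ext_contract i y (U - A)"
        using iA by (simp add: ext_contract_def flip: mult.assoc)
    qed simp
    finally show ?thesis by (simp add: add.commute)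
  next
    case True
    define W where "W = U - {i}"
    have W: "U = insert i W" "i \<notin> W" "finite W" using True fU by (auto simp: W_def)
    have Pow: "Pow U = Pow W \<union> insert i ` Pow W" unfolding W(1) by (rule Pow_insert)
    have disj: "Pow W \<inter> insert i ` Pow W = {}" using W by auto
    have inj: "inj_on (insert i) (Pow W)" using W by (auto simp: inj_on_def)
    have fW: "finite (Pow W)" "finite (insert i ` Pow W)" using W by auto
    have "ext_mult (ext_contract i x) y U =
        (\<Sum>A\<in>Pow W. ?s A (U - A) * ext_contract i x A * y (U - A))"
      unfolding ext_mult_def Pow using fW
      by (intro sum.mono_neutral_right) (auto simp: ext_contract_def)
    moreover have "ext_mult (\<lambda>S. (- 1) ^ card S * x S) (ext_contract i y) U =
        (\<Sum>A\<in>insert i ` Pow W. ?s A (U - A) * ((- 1) ^ card A * x A) * ext_contract i y (U - A))"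
      unfolding ext_mult_def Pow using fW W
      by (intro sum.mono_neutral_right) (auto simp: ext_contract_def)
    moreover have "\<dots> = (\<Sum>A\<in>Pow W. - (?s A (U - A) * ext_contract i x A * y (U - A)))"
    proof (subst sum.reindex[OF inj], rule sum.cong)
      fix A assume A: "A \<in> Pow W"
      then have iA: "i \<notin> A" "i \<notin> W - A" "U - A = insert i (W - A)" "U - insert i A = W - A"
        and f: "finite A" "finite (W - A)" using W by (auto intro: finite_subset)
      have 1: "?s (insert i A) (W - A) = ?s {i} (W - A) * ?s A (W - A)"
        using iA f ext_sign_Un_left[of "{i}" A "W - A"] by auto
      have 2: "?s A (U - A) = ?s A {i} * ?s A (W - A)"
        using iA f ext_sign_Un_right[of "{i}" "W - A" A] by auto
      have "?s (insert i A) (W - A) * (- 1) ^ card (insert i A) * ?s {i} (W - A) =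
          - ((?s {i} (W - A) * ?s {i} (W - A)) * (- 1) ^ card A * ?s A (W - A))"
        using iA f by (simp add: 1 mult_ac)
      also have "\<dots> = - ((?s {i} A * ?s A {i}) * ?s A (W - A))"
        using iA f by (simp add: ext_sign_square ext_sign_swap)
      also have "\<dots> = - (?s A (U - A) * ?s {i} A)" by (simp add: 2 mult_ac)
      finally have "(?s (insert i A) (W - A) * (- 1) ^ card (insert i A) * ?s {i} (W - A))
          * (x (insert i A) * y (U - A)) =
        - (?s A (U - A) * ?s {i} A) * (x (insert i A) * y (U - A))" by simp
      then show "((\<lambda>A. ?s A (U - A) * ((- 1) ^ card A * x A) * ext_contract i y (U - A)) \<circ> insert i) A =
         - (?s A (U - A) * ext_contract i x A * y (U - A))"
        using iA by (simp add: ext_contract_def mult_ac)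
    qed simp
    ultimately show ?thesis using True by (simp add: ext_contract_def sum_negf)
  qed
qed

lemma ext_deriv_basis_singleton:
  assumes "finite G" "i \<in> G"
  shows "ext_deriv G (ext_basis {i}) = (ext_basis {} :: _ \<Rightarrow> 'k::field)"
proof
  fix S
  have "ext_deriv G (ext_basis {i}) S = (\<Sum>j\<in>G. if j = i then (ext_basis {} S :: 'k) else 0)"
    unfolding ext_deriv_contract[OF assms(1)] ext_contract_def ext_basis_def
    by (rule sum.cong) (auto dest: equalityD1)
  then show "ext_deriv G (ext_basis {i}) S = (ext_basis {} S :: 'k)" using assms by simp
qed

lemma ext_deriv_mult:
  assumes "finite G" "x \<in> ext_degree G p"
  shows "ext_deriv G (ext_mult x y) U =
    ext_mult (ext_deriv G x) y U + (- 1) ^ p * ext_mult x (ext_deriv G y) (U :: 'i::linorder set)"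
proof -
  have x: "(\<lambda>S. (- 1) ^ card S * x S) = (\<lambda>S. (- 1) ^ p * x S)"
    using assms(2) by (fastforce simp: ext_degree_def)
  have 1: "ext_mult (ext_deriv G x) y U = (\<Sum>i\<in>G. ext_mult (ext_contract i x) y U)"
    unfolding ext_mult_def ext_deriv_contract[OF assms(1)]
    by (subst sum.swap) (simp add: sum_distrib_left sum_distrib_right)
  have 2: "(- 1) ^ p * ext_mult x (ext_deriv G y) U =
      (\<Sum>i\<in>G. ext_mult (\<lambda>S. (- 1) ^ card S * x S) (ext_contract i y) U)"
    unfolding ext_mult_def ext_deriv_contract[OF assms(1)] x
    by (subst sum.swap) (simp add: sum_distrib_left sum_distrib_right mult_ac)
  show ?thesis
    unfolding 1 2 by (simp add: ext_deriv_contract[OF assms(1)] ext_contract_mult sum.distrib)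
qed

end

theory Submission
  imports Defs "HOL-Library.Function_Algebras"
begin

text \<open>
  If \<open>v\<close> does not lie in \<open>P\<^sub>\<C>\<close> for any admissible cover \<open>\<C>\<close>, then either \<open>\<Sum>v\<^sub>j \<noteq> 0\<close>, and \<open>\<partial>\<close> contracts
  \<open>(A, \<cdot>v)\<close>, or some \<open>i\<close> lies on no irreducible flat of rank at most \<open>p + 1\<close> over which \<open>v\<close> sums to \<open>0\<close>.
  In the latter case, every flat \<open>Y\<close> of rank at most \<open>p + 1\<close> containing \<open>i\<close> has an acyclic complex
  \<open>(A(Y), \<cdot>v|\<^sub>Y)\<close>: the derivation \<open>\<Sum>j\<in>K. \<partial>/\<partial>e\<^sub>j\<close>, where \<open>K\<close> is the connected component of \<open>i\<close> in \<open>Y\<close>,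
  preserves the ideal and is a contracting homotopy up to the factor \<open>v\<^sub>K \<noteq> 0\<close>.

  To globalise, split \<open>A = N \<oplus> P\<close>, with \<open>N\<close> spanned by the \<open>e\<^sub>S\<close> with \<open>i\<close> outside the closure of \<open>S\<close>. The
  \<open>P\<close>-component of multiplication by \<open>v\<close> maps \<open>N\<close> in degree \<open>q - 1\<close> to \<open>P\<close> in degree \<open>q\<close>, and it is
  block diagonal over the flats \<open>Y\<close> of rank \<open>q\<close> containing \<open>i\<close>. By induction on \<open>q\<close>, the
  acyclicity of the \<open>(A(Y), \<cdot>v|\<^sub>Y)\<close> makes it surjective for \<open>q \<le> p\<close> and injective for \<open>q \<le> p + 1\<close>.
  A cocycle of degree \<open>p\<close> can therefore be moved into \<open>N\<close> by a coboundary, where it has to vanish.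
\<close>

section \<open>Closure, circuits and components\<close>

context matroid
begin

section \<open>Rank, bases and closure in a matroid\<close>

abbreviation rk :: "'a set \<Rightarrow> nat" where "rk \<equiv> rank_of indep"

text \<open>The restriction to \<open>ground\<close> matters: an element outside the ground set
  never raises the rank, so without it every such element would belong to each closure.\<close>

definition cl :: "'a set \<Rightarrow> 'a set" where
  "cl S = {x \<in> ground. rk (insert x S) = rk S}"

lemma finite_indep: "indep S \<Longrightarrow> finite S"
  using indep_subset_ground finite_ground finite_subset by blast

lemma finite_indep_subsets: "finite {S. S \<subseteq> X \<and> indep S}"
  by (rule finite_subset[of _ "Pow ground"]) (use indep_subset_ground finite_ground in auto)

lemma card_le_rk: "indep T \<Longrightarrow> T \<subseteq> S \<Longrightarrow> card T \<le> rk S"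
  unfolding rank_of_def using finite_indep_subsets by (intro Max_ge) auto

lemma ex_basis: "\<exists>B\<subseteq>S. indep B \<and> card B = rk S"
proof -
  have "rk S \<in> card ` {T. T \<subseteq> S \<and> indep T}"
    unfolding rank_of_def using finite_indep_subsets indep_empty by (intro Max_in) auto
  then show ?thesis by auto
qed

text \<open>Augmentation against a maximum independent subset of \<open>S\<close> adds one element
  at a time, and the deficit \<open>rk S - card T\<close> drops at each step.\<close>

lemma basis_extend:
  assumes "indep T" "T \<subseteq> S"
  shows "\<exists>B. T \<subseteq> B \<and> B \<subseteq> S \<and> indep B \<and> card B = rk S"
  using assms
proof (induction "rk S - card T" arbitrary: T rule: less_induct)
  case less
  show ?case
  proof (cases "card T = rk S")
    case True
    then show ?thesis using less.prems by auto
  next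
    case False
    then have lt: "card T < rk S" using card_le_rk[OF less.prems] by simp
    obtain B where B: "B \<subseteq> S" "indep B" "card B = rk S" using ex_basis by blast
    obtain x where x: "x \<in> B - T" "indep (insert x T)"
      using augmentation[of T B] less.prems B lt by auto
    have "card (insert x T) = Suc (card T)" using x finite_indep[OF less.prems(1)] by simp
    then have "rk S - card (insert x T) < rk S - card T" using lt by simp
    from less.hyps[OF this x(2)] x B less.prems show ?thesis by blast
  qed
qed

lemma rk_eq_card_indep: "indep S \<Longrightarrow> rk S = card S"
  using basis_extend[of S S] by force

lemma rk_mono:
  assumes "S \<subseteq> T" shows "rk S \<le> rk T"
proof -
  obtain B where B: "B \<subseteq> S" "indep B" "card B = rk S" using ex_basis by blast
  then show ?thesis using card_le_rk[of B T] assms by simp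
qed

lemma rk_insert_ge: "rk S \<le> rk (insert x S)"
  by (rule rk_mono) auto

lemma rk_insert_le: "rk (insert x S) \<le> Suc (rk S)"
proof -
  obtain B where B: "B \<subseteq> insert x S" "indep B" "card B = rk (insert x S)" using ex_basis by blast
  have "card (B - {x}) \<le> rk S"
    by (rule card_le_rk) (use B indep_mono in auto)
  moreover have "card B \<le> Suc (card (B - {x}))" by (cases "x \<in> B") (simp_all add: card_Suc_Diff1)
  ultimately show ?thesis using B(3) by simp
qed

text \<open>Reduces closure to one chosen basis, so that later closure facts follow by extending
  independent sets.\<close>

lemma mem_cl_basis:
  assumes "B \<subseteq> S" "indep B" "card B = rk S"
  shows "x \<in> cl S \<longleftrightarrow> x \<in> ground \<and> (x \<in> B \<or> \<not> indep (insert x B))"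
proof (cases "x \<in> B")
  case True
  then show ?thesis using assms by (auto simp: cl_def insert_absorb subsetD)
next
  case False
  have "rk (insert x S) = rk S \<longleftrightarrow> \<not> indep (insert x B)"
  proof
    assume a: "rk (insert x S) = rk S"
    show "\<not> indep (insert x B)"
    proof
      assume "indep (insert x B)"
      from card_le_rk[OF this, of "insert x S"] show False
        using assms a False finite_indep by auto
    qed
  next
    assume dep: "\<not> indep (insert x B)"
    \<comment> \<open>A basis of \<open>insert x S\<close> that extends \<open>B\<close> cannot
      contain \<open>x\<close>; it therefore lies in \<open>S\<close>, and the rank does not
      grow.\<close>
    obtain B' where B': "B \<subseteq> B'" "B' \<subseteq> insert x S" "indep B'" "card B' = rk (insert x S)"
      using basis_extend[of B "insert x S"] assms by auto
    have "x \<notin> B'" using B' dep indep_mono[of B' "insert x B"] by blast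
    then have "card B' \<le> rk S" using B' by (intro card_le_rk) auto
    then show "rk (insert x S) = rk S" using B' rk_insert_ge[of S x] by auto
  qed
  then show ?thesis using False by (simp add: cl_def)
qed

lemma cl_subset_ground: "cl S \<subseteq> ground" by (auto simp: cl_def)

lemma cl_extensive: "S \<subseteq> ground \<Longrightarrow> S \<subseteq> cl S"
  by (auto simp: cl_def insert_absorb)

lemma cl_mono: assumes "S \<subseteq> T" shows "cl S \<subseteq> cl T"
proof
  fix x assume x: "x \<in> cl S"
  obtain B where B: "B \<subseteq> S" "indep B" "card B = rk S" using ex_basis by blast
  obtain B' where B': "B \<subseteq> B'" "B' \<subseteq> T" "indep B'" "card B' = rk T"
    using basis_extend[OF B(2), of T] assms B(1) by auto
  show "x \<in> cl T"
    using x mem_cl_basis[OF B, of x] mem_cl_basis[OF B'(2-4), of x] B'(1)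
      indep_mono[of "insert x B'" "insert x B"] by auto
qed

lemma rk_cl:
  assumes "S \<subseteq> ground"
  shows "rk (cl S) = rk S"
proof -
  obtain B where B: "B \<subseteq> S" "indep B" "card B = rk S" using ex_basis by blast
  have "B \<subseteq> cl S" using B(1) cl_extensive[OF assms] by (rule subset_trans)
  then obtain B' where B': "B \<subseteq> B'" "B' \<subseteq> cl S" "indep B'" "card B' = rk (cl S)"
    using basis_extend[OF B(2), of "cl S"] by blast
  have "B' \<subseteq> B"
  proof
    fix x assume x: "x \<in> B'"
    then have "indep (insert x B)" using B' indep_mono[of B' "insert x B"] by simp
    then show "x \<in> B" using x B'(2) mem_cl_basis[OF B, of x] by blast
  qed
  then have "B' = B" using B'(1) by (rule subset_antisym)
  then show ?thesis using B'(4) B(3) by simp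
qed

text \<open>A basis of the smaller set is, by equality of ranks, also a basis of the larger
  one.\<close>

lemma cl_eq_of_rk:
  assumes "S \<subseteq> T" "rk S = rk T"
  shows "cl S = cl T"
proof -
  obtain B where B: "B \<subseteq> S" "indep B" "card B = rk S" using ex_basis by blast
  with assms have B': "B \<subseteq> T" "indep B" "card B = rk T" by auto
  show ?thesis using mem_cl_basis[OF B] mem_cl_basis[OF B'] by blast
qed

lemma cl_idem: "S \<subseteq> ground \<Longrightarrow> cl (cl S) = cl S"
  using cl_eq_of_rk[OF cl_extensive] rk_cl by auto

lemma cl_minimal: "S \<subseteq> X \<Longrightarrow> cl X = X \<Longrightarrow> cl S \<subseteq> X"
  using cl_mono by blast

lemma subset_closed_iff: "S \<subseteq> ground \<Longrightarrow> cl X = X \<Longrightarrow> S \<subseteq> X \<longleftrightarrow> cl S \<subseteq> X"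
  using cl_minimal cl_extensive by blast

lemma cl_indep_in_closed:
  assumes "indep S" "S \<subseteq> X" "cl X = X" "card S = rk X"
  shows "cl S = X"
  using cl_eq_of_rk[of S X] rk_eq_card_indep assms by simp

text \<open>A rank count: \<open>insert i S\<close> already has rank \<open>Suc (rk S)\<close>, and
  adding \<open>j\<close> as well cannot exceed this because \<open>i\<close> is in the closure of
  \<open>insert j S\<close>.\<close>

lemma exchange:
  assumes "S \<subseteq> ground" "j \<in> ground" "i \<in> cl (insert j S)" "i \<notin> cl S"
  shows "j \<in> cl (insert i S)"
proof -
  have i: "i \<in> ground" using assms cl_subset_ground by blast
  have le: "rk (insert i S) = Suc (rk S)" "rk S \<le> rk (insert i S)"
    using assms(4) i rk_insert_le[of i S] rk_insert_ge[of S i] by (auto simp: cl_def)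
  have "rk (insert i (insert j S)) = rk (insert j S)" using assms(3) by (simp add: cl_def)
  then have "rk (insert j (insert i S)) \<le> Suc (rk S)"
    using rk_insert_le[of j S] by (simp add: insert_commute)
  then have "rk (insert j (insert i S)) = rk (insert i S)"
    using le rk_insert_ge[of "insert i S" j] by auto
  then show ?thesis using assms(2) by (simp add: cl_def)
qed

lemma rk_insert_notin_cl:
  assumes "i \<in> ground" "i \<notin> cl S"
  shows "rk (insert i S) = Suc (rk S)"
  using assms rk_insert_le[of i S] rk_insert_ge[of S i] by (auto simp: cl_def)

lemma flat_iff_closed: "flat ground indep X \<longleftrightarrow> cl X = X"
proof
  assume f: "flat ground indep X"
  then have "X \<subseteq> cl X" using cl_extensive by (auto simp: flat_def)
  moreover have "cl X \<subseteq> X" using f unfolding flat_def cl_def by force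
  ultimately show "cl X = X" by blast
next
  assume c: "cl X = X"
  have "rk (insert x X) > rk X" if "x \<in> ground - X" for x
    using that c rk_insert_notin_cl[of x X] by auto
  then show "flat ground indep X" using c cl_subset_ground[of X] by (auto simp: flat_def)
qed

section \<open>Circuits and connected components\<close>

abbreviation circ :: "'a set \<Rightarrow> bool" where "circ \<equiv> circuit ground indep"

lemma circ_subset_ground: "circ C \<Longrightarrow> C \<subseteq> ground" by (simp add: circuit_def)

lemma circ_nonempty: "circ C \<Longrightarrow> C \<noteq> {}" using indep_empty by (auto simp: circuit_def)

lemma circ_not_psubset: "circ C \<Longrightarrow> circ D \<Longrightarrow> D \<subseteq> C \<Longrightarrow> D = C"
  by (auto simp: circuit_def)

lemma dep_contains_circ:
  assumes "S \<subseteq> ground" "\<not> indep S"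
  shows "\<exists>C\<subseteq>S. circ C"
proof -
  have "finite S" using assms(1) finite_ground by (rule finite_subset)
  then show ?thesis using assms
  proof (induction S rule: finite_psubset_induct)
    case (psubset S)
    show ?case
    proof (cases "\<forall>D. D \<subset> S \<longrightarrow> indep D")
      case True
      with psubset.prems have "circ S" by (simp add: circuit_def)
      then show ?thesis by blast
    next
      case False
      then obtain D where "D \<subset> S" "\<not> indep D" by blast
      then obtain C where "C \<subseteq> D" "circ C" using psubset.IH[of D] psubset.prems(1) by auto
      then show ?thesis using \<open>D \<subset> S\<close> by blast
    qed
  qed
qed

lemma circ_mem_cl:
  assumes "circ C" "x \<in> C"
  shows "x \<in> cl (C - {x})"
proof -
  have "C - {x} \<subset> C" using assms(2) by blast
  then have i: "indep (C - {x})" using assms(1) unfolding circuit_def by blast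
  have "insert x (C - {x}) = C" using assms(2) by blast
  then show ?thesis
    using mem_cl_basis[OF subset_refl i rk_eq_card_indep[OF i, symmetric], of x] assms(2)
      assms(1)[unfolded circuit_def] by auto
qed

text \<open>The circuit is the fundamental circuit of \<open>x\<close> with respect to a basis of
  \<open>S\<close>.\<close>

lemma mem_cl_circ:
  assumes "x \<in> cl S" "x \<notin> S" "S \<subseteq> ground"
  shows "\<exists>C. circ C \<and> x \<in> C \<and> C \<subseteq> insert x S"
proof -
  obtain B where B: "B \<subseteq> S" "indep B" "card B = rk S" using ex_basis by blast
  have "x \<in> ground" "\<not> indep (insert x B)" using assms mem_cl_basis[OF B, of x] B by auto
  then obtain C where C: "C \<subseteq> insert x B" "circ C"
    using dep_contains_circ[of "insert x B"] B assms by blast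
  then have "\<not> C \<subseteq> B" using B(2) indep_mono[of B C] unfolding circuit_def by blast
  then have "x \<in> C" "C \<subseteq> insert x S" using C(1) B(1) by auto
  then show ?thesis using C(2) by blast
qed

text \<open>An element of a circuit lies in the closure of the others. This is why all monomials of
  \<partial>(e_C), and of its monomial multiples, span the same flat.\<close>

lemma cl_Un_circ_Diff:
  assumes "circ C" "S \<subseteq> ground"
  shows "cl (S \<union> (C - {x})) = cl (S \<union> C)"
proof
  show "cl (S \<union> (C - {x})) \<subseteq> cl (S \<union> C)" by (rule cl_mono) auto
  have g: "S \<union> C \<subseteq> ground" "S \<union> (C - {x}) \<subseteq> ground" using assms circ_subset_ground by auto
  have "x \<in> cl (S \<union> (C - {x}))" if "x \<in> C"
    using circ_mem_cl[OF assms(1) that] cl_mono[of "C - {x}" "S \<union> (C - {x})"] by auto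
  then have "S \<union> C \<subseteq> cl (S \<union> (C - {x}))" using cl_extensive[OF g(2)] by blast
  then show "cl (S \<union> C) \<subseteq> cl (S \<union> (C - {x}))" by (rule cl_minimal) (rule cl_idem[OF g(2)])
qed

text \<open>With \<open>W\<close> the union without \<open>x\<close> and \<open>y\<close>, the
  circuit \<open>C2\<close> puts \<open>y\<close> into the closure of \<open>W\<close>, and then
  \<open>C1\<close> puts \<open>x\<close> there; a circuit through \<open>x\<close> inside
  \<open>insert x W\<close> results.\<close>

lemma strong_elimination:
  assumes "circ C1" "circ C2" "y \<in> C1 \<inter> C2" "x \<in> C1 - C2"
  shows "\<exists>C. circ C \<and> x \<in> C \<and> C \<subseteq> C1 \<union> C2 - {y}"
proof -
  define W where "W = C1 \<union> C2 - {x, y}"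
  have W: "W \<subseteq> ground" using assms circ_subset_ground by (auto simp: W_def)
  have "y \<in> cl W"
    using circ_mem_cl[of C2 y] cl_mono[of "C2 - {y}" W] assms by (auto simp: W_def)
  then have "insert y W \<subseteq> cl W" using cl_extensive[OF W] by auto
  moreover have "x \<in> cl (insert y W)"
    using circ_mem_cl[of C1 x] cl_mono[of "C1 - {x}" "insert y W"] assms by (auto simp: W_def)
  ultimately have "x \<in> cl W" using cl_minimal[of "insert y W" "cl W"] cl_idem[OF W] by auto
  then obtain C where "circ C" "x \<in> C" "C \<subseteq> insert x W"
    using mem_cl_circ[of x W] W by (auto simp: W_def)
  then show ?thesis using assms by (auto simp: W_def)
qed

text \<open>Transitivity of lying on a common circuit. Induction on the size of the union:
  eliminating a common element \<open>y\<close> yields circuits through \<open>x\<close> and through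
  \<open>z\<close>, from which an intersecting pair with smaller union can be chosen.\<close>

lemma circ_connect:
  assumes "circ C1" "circ C2" "C1 \<inter> C2 \<noteq> {}" "x \<in> C1" "z \<in> C2"
  shows "\<exists>C. circ C \<and> x \<in> C \<and> z \<in> C \<and> C \<subseteq> C1 \<union> C2"
  using assms
proof (induction "card (C1 \<union> C2)" arbitrary: C1 C2 rule: less_induct)
  case less
  show ?case
  proof (cases "x \<in> C2 \<or> z \<in> C1")
    case True
    then show ?thesis using less.prems by blast
  next
    case False
    obtain y where y: "y \<in> C1 \<inter> C2" using less.prems by blast
    have fin: "finite (C1 \<union> C2)"
      using less.prems(1,2) circ_subset_ground finite_subset[OF _ finite_ground] by simp
    have IH: "\<exists>C. circ C \<and> x \<in> C \<and> z \<in> C \<and> C \<subseteq> C1 \<union> C2" if "circ D1" "circ D2" "D1 \<inter> D2 \<noteq> {}" "x \<in> D1" "z \<in> D2"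
      "D1 \<union> D2 \<subset> C1 \<union> C2" for D1 D2
      using less.hyps[of D1 D2, OF psubset_card_mono[OF fin that(6)] that(1-5)] that(6) by blast
    obtain C3 where C3: "circ C3" "x \<in> C3" "C3 \<subseteq> C1 \<union> C2 - {y}"
      using strong_elimination[of C1 C2 y x] less.prems y False by blast
    obtain C4 where C4: "circ C4" "z \<in> C4" "C4 \<subseteq> C2 \<union> C1 - {y}"
      using strong_elimination[of C2 C1 y z] less.prems y False by blast
    have "\<not> C3 \<subseteq> C1" using circ_not_psubset[of C1 C3] C3 less.prems y by blast
    then have 3: "C3 \<inter> C2 \<noteq> {}" using C3 by blast
    have "\<not> C4 \<subseteq> C2" using circ_not_psubset[of C2 C4] C4 less.prems y by blast
    then have 4: "C4 \<inter> (C1 - C2) \<noteq> {}" using C4 by blast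
    \<comment> \<open>Either \<open>C3\<close> misses some element of \<open>C1 - C2\<close>, and
      the union with \<open>C2\<close> shrinks, or \<open>C3\<close> contains all of
      \<open>C1 - C2\<close>, hence meets \<open>C4\<close>, and the union of these two misses
      \<open>y\<close>.\<close>
    show ?thesis
    proof (cases "C1 - C2 \<subseteq> C3")
      case False
      then have "C3 \<union> C2 \<subset> C1 \<union> C2" using C3 by blast
      then show ?thesis using IH[of C3 C2] C3 3 less.prems by blast
    next
      case True
      then have "C3 \<inter> C4 \<noteq> {}" "C3 \<union> C4 \<subset> C1 \<union> C2" using 4 C3 C4 y by blast+
      then show ?thesis using IH[of C3 C4] C3 C4 by blast
    qed
  qed
qed

text \<open>The explicit \<open>insert i\<close> takes care of an \<open>i\<close> that lies on no
  circuit inside \<open>X\<close>; its component is then the singleton.\<close>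

definition component :: "'a set \<Rightarrow> 'a \<Rightarrow> 'a set" where
  "component X i = insert i {j. \<exists>C. circ C \<and> C \<subseteq> X \<and> i \<in> C \<and> j \<in> C}"

lemma component_subset: "i \<in> X \<Longrightarrow> component X i \<subseteq> X"
  by (auto simp: component_def)

text \<open>A circuit meeting the component can be joined to \<open>i\<close> by
  \<open>circ_connect\<close>. This dichotomy is what makes the derivation along a component
  compatible with the Orlik-Solomon relations.\<close>

lemma component_separates:
  assumes "circ C" "C \<subseteq> X"
  shows "C \<subseteq> component X i \<or> C \<inter> component X i = {}"
proof (rule disjCI)
  assume "C \<inter> component X i \<noteq> {}"
  then obtain k where k: "k \<in> C" "k \<in> component X i" by blast
  show "C \<subseteq> component X i"
  proof (cases "i \<in> C")
    case True
    then show ?thesis using assms by (auto simp: component_def)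
  next
    case False
    then obtain D where D: "circ D" "D \<subseteq> X" "i \<in> D" "k \<in> D"
      using k by (auto simp: component_def)
    show ?thesis
    proof
      fix j assume "j \<in> C"
      then obtain C' where "circ C'" "i \<in> C'" "j \<in> C'" "C' \<subseteq> D \<union> C"
        using circ_connect[of D C i j] D assms k by blast
      moreover from this(4) have "C' \<subseteq> X" using D assms by blast
      ultimately show "j \<in> component X i" by (auto simp: component_def)
    qed
  qed
qed

lemma circuit_restriction:
  assumes "circ C" "C \<subseteq> X"
  shows "circuit X (restriction indep X) C"
  using assms by (auto simp: circuit_def restriction_def)

lemma component_connected:
  assumes "i \<in> X"
  shows "connected_matroid (component X i) (restriction indep (component X i))"
  unfolding connected_matroid_def
proof (intro ballI impI)
  fix x y assume xy: "x \<in> component X i" "y \<in> component X i" "x \<noteq> y"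
  have ex: "\<exists>C. circ C \<and> x \<in> C \<and> y \<in> C \<and> C \<subseteq> X"
  proof (cases "x = i \<or> y = i")
    case True
    then show ?thesis using xy by (auto simp: component_def)
  next
    case False
    then obtain C D where "circ C" "C \<subseteq> X" "i \<in> C" "x \<in> C" "circ D" "D \<subseteq> X" "i \<in> D" "y \<in> D"
      using xy by (auto simp: component_def)
    then show ?thesis using circ_connect[of C D x y] by blast
  qed
  then obtain C where C: "circ C" "x \<in> C" "y \<in> C" "C \<subseteq> X" by blast
  have "C \<subseteq> component X i" using component_separates[OF C(1,4), of i] C(2) xy(1) by blast
  then show "\<exists>C. circuit (component X i) (restriction indep (component X i)) C \<and> x \<in> C \<and> y \<in> C"
    using C(2,3) circuit_restriction[OF C(1)] by blast
qed

lemma component_closed: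
  assumes X: "cl X = X" "i \<in> X" and loopless: "\<And>x. x \<in> ground \<Longrightarrow> indep {x}"
  shows "cl (component X i) = component X i"
proof (rule subset_antisym)
  let ?K = "component X i"
  have K: "?K \<subseteq> X" by (rule component_subset[OF X(2)])
  have "X \<subseteq> ground" using cl_subset_ground[of X] unfolding X(1) .
  with K have Kg: "?K \<subseteq> ground" by (rule subset_trans)
  show "?K \<subseteq> cl ?K" using Kg by (rule cl_extensive)
  show "cl ?K \<subseteq> ?K"
  proof
    fix x assume x: "x \<in> cl ?K"
    show "x \<in> ?K"
    proof (rule ccontr)
      assume nx: "x \<notin> ?K"
      have "x \<in> X" using x cl_minimal[OF K X(1)] by blast
      obtain C where C: "circ C" "x \<in> C" "C \<subseteq> insert x ?K" using mem_cl_circ[OF x nx Kg] by blast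
      \<comment> \<open>Absence of loops forces a second element of \<open>C\<close>, which then
        lies in the component; separation pulls \<open>x\<close> in as well.\<close>
      have "C \<noteq> {x}" using C loopless[of x] by (auto simp: circuit_def)
      then have "C \<inter> ?K \<noteq> {}" using C by blast
      then show False using component_separates[OF C(1), of X i] C \<open>x \<in> X\<close> K nx by blast
    qed
  qed
qed

text \<open>Turns any flat of small rank through \<open>i\<close> into an irreducible one through
  \<open>i\<close>, a candidate member of a cover.\<close>

lemma component_in_L_irr_le:
  assumes "cl X = X" "i \<in> X" "rk X \<le> m" "\<And>x. x \<in> ground \<Longrightarrow> indep {x}"
  shows "component X i \<in> L_irr_le m ground indep"
proof -
  have "flat ground indep (component X i)"
    unfolding flat_iff_closed by (rule component_closed[OF assms(1,2,4)])
  moreover have "component X i \<noteq> {}" by (simp add: component_def)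
  moreover have "rk (component X i) \<le> m"
    using rk_mono[OF component_subset[OF assms(2)]] assms(3) by (rule order_trans)
  ultimately show ?thesis
    using component_connected[OF assms(2)] by (simp add: L_irr_le_def)
qed

end

section \<open>Derivations of the exterior algebra\<close>

abbreviation (input) scl :: "'k::field \<Rightarrow> ('i set \<Rightarrow> 'k) \<Rightarrow> 'i set \<Rightarrow> 'k" where
  "scl c x \<equiv> (\<lambda>S. c * x S)"

section \<open>Bilinearity and supports of exterior products\<close>

lemma sum_fun_apply: "(\<Sum>a\<in>A. f a) x = (\<Sum>a\<in>A. f a x)"
  by (induction A rule: infinite_finite_induct) auto

lemma ext_mult_add_left: "ext_mult (x + y) z = ext_mult x z + ext_mult y z"
  by (rule ext) (simp add: ext_mult_def algebra_simps sum.distrib)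

lemma ext_mult_add_right: "ext_mult x (y + z) = ext_mult x y + ext_mult x z"
  by (rule ext) (simp add: ext_mult_def algebra_simps sum.distrib)

lemma ext_mult_diff_left: "ext_mult (x - y) z = ext_mult x z - ext_mult y z"
  by (rule ext) (simp add: ext_mult_def algebra_simps sum_subtractf)

lemma ext_mult_zero_left [simp]: "ext_mult 0 z = 0"
  by (rule ext) (simp add: ext_mult_def)

lemma ext_mult_zero_right [simp]: "ext_mult x 0 = 0"
  by (rule ext) (simp add: ext_mult_def)

lemma ext_mult_scl_left: "ext_mult (scl c x) z = scl c (ext_mult x z)"
  by (rule ext) (simp add: ext_mult_def sum_distrib_left mult_ac)

lemma ext_mult_scl_right: "ext_mult x (scl c z) = scl c (ext_mult x z)"
  by (rule ext) (simp add: ext_mult_def sum_distrib_left mult_ac)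

lemma ext_mult_sum_left: "ext_mult (\<Sum>a\<in>A. f a) z = (\<Sum>a\<in>A. ext_mult (f a) z)"
  by (rule ext) (simp add: ext_mult_def sum_fun_apply sum_distrib_left sum_distrib_right sum.swap[of _ A])

lemma ext_mult_sum_right: "ext_mult z (\<Sum>a\<in>A. f a) = (\<Sum>a\<in>A. ext_mult z (f a))"
  by (rule ext) (simp add: ext_mult_def sum_fun_apply sum_distrib_left sum.swap[of _ A])

lemma ext_mult_support:
  assumes "ext_mult x y U \<noteq> 0"
  shows "\<exists>S\<subseteq>U. x S \<noteq> 0 \<and> y (U - S) \<noteq> 0"
proof (rule ccontr)
  assume "\<not> ?thesis"
  then have "ext_sign S (U - S) * x S * y (U - S) = 0" if "S \<in> Pow U" for S using that by auto
  then have "ext_mult x y U = 0" unfolding ext_mult_def by (rule sum.neutral[OF ballI])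
  with assms show False by simp
qed

lemma ext_vec_support:
  assumes "ext_vec X v S \<noteq> 0"
  shows "\<exists>j\<in>X. S = {j}"
proof (rule ccontr)
  assume "\<not> ?thesis"
  then have "ext_vec X v S = 0" unfolding ext_vec_def ext_basis_def by (intro sum.neutral) auto
  with assms show False by simp
qed

lemma ext_vec_singleton:
  assumes "finite X"
  shows "ext_vec X v {j} = (if j \<in> X then v j else 0)"
proof -
  have "ext_vec X v {j} = (\<Sum>i\<in>X. if i = j then v i else 0)"
    unfolding ext_vec_def ext_basis_def by (rule sum.cong) auto
  then show ?thesis using assms by simp
qed

lemma ext_vec_split:
  assumes "finite X" "Y \<subseteq> X"
  shows "ext_vec X v = ext_vec Y v + ext_vec (X - Y) v"
  using sum.subset_diff[OF assms(2,1)] by (intro ext) (simp add: ext_vec_def add.commute)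

lemma mult_vec_support:
  assumes "ext_mult x (ext_vec X v) U \<noteq> 0"
  shows "\<exists>j\<in>U \<inter> X. x (U - {j}) \<noteq> 0"
proof -
  obtain S where S: "S \<subseteq> U" "x S \<noteq> 0" "ext_vec X v (U - S) \<noteq> 0"
    using ext_mult_support[OF assms] by blast
  obtain j where j: "j \<in> X" "U - S = {j}" using ext_vec_support[OF S(3)] by blast
  then have "U - {j} = S" using S(1) by blast
  then show ?thesis using S j by blast
qed

lemma ext_mult_local:
  assumes "\<And>S. S \<subseteq> U \<Longrightarrow> x S = x' S" "\<And>S. S \<subseteq> U \<Longrightarrow> y S = y' S"
  shows "ext_mult x y U = ext_mult x' y' U"
  unfolding ext_mult_def using assms by (intro sum.cong) auto

section \<open>Derivations along subsets of the ground set\<close>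

lemma ext_deriv_support:
  assumes "ext_deriv K x S \<noteq> 0"
  shows "\<exists>i\<in>K - S. x (insert i S) \<noteq> 0"
proof (rule ccontr)
  assume "\<not> ?thesis"
  then have "ext_deriv K x S = 0" unfolding ext_deriv_def by (intro sum.neutral) auto
  with assms show False by simp
qed

lemma ext_deriv_add: "ext_deriv K (x + y) = ext_deriv K x + ext_deriv K y"
  by (rule ext) (simp add: ext_deriv_def algebra_simps sum.distrib)

lemma ext_deriv_scl: "ext_deriv K (scl c x) = scl c (ext_deriv K x)"
  by (rule ext) (simp add: ext_deriv_def sum_distrib_left mult_ac)

lemma ext_deriv_zero [simp]: "ext_deriv K 0 = 0"
  by (rule ext) (simp add: ext_deriv_def)

text \<open>
  \<open>ext_deriv K\<close> for a subset \<open>K\<close> of the ground set is the derivation with \<open>e\<^sub>i \<mapsto> 1\<close> for \<open>i \<in> K\<close> and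
  \<open>e\<^sub>i \<mapsto> 0\<close> for the other \<open>i\<close>.
\<close>

lemma ext_deriv_twisted_Leibniz:
  assumes "finite K"
  shows "ext_deriv K (ext_mult x y) =
    ext_mult (ext_deriv K x) y + ext_mult (\<lambda>S. (- 1) ^ card S * x S) (ext_deriv K y)"
proof
  fix U
  have 1: "ext_mult (ext_deriv K x) y U = (\<Sum>i\<in>K. ext_mult (ext_contract i x) y U)"
    unfolding ext_mult_def ext_deriv_contract[OF assms]
    by (subst sum.swap) (simp add: sum_distrib_left sum_distrib_right)
  have 2: "ext_mult (\<lambda>S. (- 1) ^ card S * x S) (ext_deriv K y) U =
      (\<Sum>i\<in>K. ext_mult (\<lambda>S. (- 1) ^ card S * x S) (ext_contract i y) U)"
    unfolding ext_mult_def ext_deriv_contract[OF assms]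
    by (subst sum.swap) (simp add: sum_distrib_left sum_distrib_right mult_ac)
  show "ext_deriv K (ext_mult x y) U =
    (ext_mult (ext_deriv K x) y + ext_mult (\<lambda>S. (- 1) ^ card S * x S) (ext_deriv K y)) U"
    unfolding plus_fun_apply 1 2
    by (simp add: ext_deriv_contract[OF assms] ext_contract_mult sum.distrib)
qed

text \<open>This scalar is the factor by which the homotopy will have to be divided.\<close>

lemma ext_deriv_vec:
  assumes "finite X" "K \<subseteq> X"
  shows "ext_deriv K (ext_vec X v) = scl (\<Sum>i\<in>K. v i) (ext_basis {})"
proof
  fix S
  show "ext_deriv K (ext_vec X v) S = scl (\<Sum>i\<in>K. v i) (ext_basis {}) S"
  proof (cases "S = {}")
    case True
    have "(\<Sum>i\<in>K. ext_vec X v {i}) = (\<Sum>i\<in>K. v i)"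
      by (rule sum.cong) (use assms in \<open>auto simp: ext_vec_singleton subset_iff\<close>)
    then show ?thesis by (simp add: True ext_deriv_def ext_basis_def)
  next
    case False
    have "ext_deriv K (ext_vec X v) S = 0"
    proof (rule ccontr)
      assume "\<not> ?thesis"
      then obtain i where i: "i \<in> K - S" "ext_vec X v (insert i S) \<noteq> 0"
        using ext_deriv_support by blast
      then obtain j where "insert i S = {j}" using ext_vec_support by blast
      then show False using i False by blast
    qed
    then show ?thesis using False by (simp add: ext_basis_def)
  qed
qed

text \<open>The terms at (i, j) and (j, i) cancel in pairs; no division by 2 occurs, so
  characteristic 2 is included.\<close>

lemma sum_antisymmetric_eq_0:
  fixes f :: "'a::linorder \<Rightarrow> 'a \<Rightarrow> 'b::ab_group_add"
  assumes "finite A" and anti: "\<And>i j. i \<in> A \<Longrightarrow> j \<in> A \<Longrightarrow> i < j \<Longrightarrow> f j i = - f i j"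
  shows "(\<Sum>i\<in>A. \<Sum>j\<in>A - {i}. f i j) = 0"
proof -
  have split: "A - {i} = {j \<in> A. i < j} \<union> {j \<in> A. j < i}" for i by auto
  have "(\<Sum>i\<in>A. \<Sum>j\<in>A - {i}. f i j) = (\<Sum>i\<in>A. (\<Sum>j\<in>{j \<in> A. i < j}. f i j) + (\<Sum>j\<in>{j \<in> A. j < i}. f i j))"
    unfolding split using assms(1) by (intro sum.cong refl sum.union_disjoint) auto
  also have "\<dots> = (\<Sum>i\<in>A. \<Sum>j\<in>{j \<in> A. i < j}. f i j) + (\<Sum>i\<in>A. \<Sum>j\<in>{j \<in> A. j < i}. f i j)"
    by (rule sum.distrib)
  also have "(\<Sum>i\<in>A. \<Sum>j\<in>{j \<in> A. j < i}. f i j) = (\<Sum>j\<in>A. \<Sum>i\<in>{i \<in> A. j < i}. f i j)"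
    using assms(1) by (rule sum.swap_restrict[OF _ assms(1)])
  also have "\<dots> = (\<Sum>j\<in>A. \<Sum>i\<in>{i \<in> A. j < i}. - f j i)"
    by (intro sum.cong refl) (auto intro: anti)
  finally show ?thesis by (simp add: sum_negf)
qed

lemma ext_deriv_deriv:
  assumes "finite K" and inf: "\<And>U. infinite U \<Longrightarrow> x U = 0"
  shows "ext_deriv K (ext_deriv K x) = 0"
proof
  fix S
  define s where "s i T = ((- 1) ^ card {j \<in> T. j < i} :: 'b)" for i :: 'a and T
  define f where "f i j = s i S * (s j (insert i S) * x (insert j (insert i S)))" for i j
  have eq: "ext_deriv K (ext_deriv K x) S = (\<Sum>i\<in>K - S. \<Sum>j\<in>K - S - {i}. f i j)"
    unfolding ext_deriv_def f_def s_def sum_distrib_left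
    by (intro sum.cong refl) auto
  show "ext_deriv K (ext_deriv K x) S = 0 S"
  proof (cases "finite S")
    case False
    then have "f i j = 0" for i j by (simp add: f_def inf)
    then show ?thesis unfolding eq by simp
  next
    case True
    have "f j i = - f i j" if "i \<in> K - S" "j \<in> K - S" "i < j" for i j
    proof -
      \<comment> \<open>The smaller index \<open>i\<close> is counted in the sign of
        \<open>j\<close>, whereas \<open>j\<close> is not counted in the sign of \<open>i\<close>;
        hence the two orders of insertion differ by exactly one sign.\<close>
      have "{k \<in> insert i S. k < j} = insert i {k \<in> S. k < j}" using that by auto
      then have "s j (insert i S) = - s j S" using that True by (simp add: s_def)
      moreover have "{k \<in> insert j S. k < i} = {k \<in> S. k < i}" using that by auto
      then have "s i (insert j S) = s i S" by (simp add: s_def)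
      ultimately show ?thesis by (simp add: f_def insert_commute)
    qed
    then show ?thesis unfolding eq using sum_antisymmetric_eq_0[of "K - S" f] assms(1) by simp
  qed
qed

text \<open>Only indices in \<open>C\<close> contribute to either side, so the index set around
  \<open>C\<close> is immaterial.\<close>

lemma ext_deriv_basis_cong:
  assumes "finite K" "finite G" "C \<subseteq> K" "C \<subseteq> G"
  shows "ext_deriv K (ext_basis C) = (ext_deriv G (ext_basis C) :: _ \<Rightarrow> 'k::field)"
proof -
  have "ext_deriv H (ext_basis C) S =
    (\<Sum>i\<in>C - S. (- 1) ^ card {j \<in> S. j < i} * (ext_basis C (insert i S) :: 'k))" if "finite H" "C \<subseteq> H" for H S
    unfolding ext_deriv_def using that
    by (intro sum.mono_neutral_right) (auto simp: ext_basis_def)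
  from this[OF assms(1,3)] this[OF assms(2,4)] show ?thesis by (intro ext) simp
qed

lemma ext_basis_expand:
  assumes "finite G" "\<And>S. x S \<noteq> 0 \<Longrightarrow> S \<subseteq> G"
  shows "x = (\<Sum>A\<in>Pow G. scl (x A) (ext_basis A))"
proof
  fix S
  have "(\<Sum>A\<in>Pow G. scl (x A) (ext_basis A)) S = (\<Sum>A\<in>Pow G. if A = S then x A else 0)"
    unfolding sum_fun_apply ext_basis_def by (rule sum.cong) auto
  then show "x S = (\<Sum>A\<in>Pow G. scl (x A) (ext_basis A)) S" using assms by auto
qed

text \<open>Apply the Leibniz rule to e_j e_C = 0.\<close>

lemma mult_basis_deriv_basis:
  assumes "finite C" "j \<in> C" "finite K" "j \<in> K"
  shows "ext_mult (ext_basis {j}) (ext_deriv K (ext_basis C)) = (ext_basis C :: _ \<Rightarrow> 'k::field)"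
proof -
  have inf: "infinite U \<Longrightarrow> ext_basis C U = (0 :: 'k)" for U using assms by (auto simp: ext_basis_def)
  have "ext_mult (ext_basis {j}) (ext_basis C) = (0 :: _ \<Rightarrow> 'k)"
    using assms by (intro ext) (simp add: ext_basis_mult)
  then have "(0 :: _ \<Rightarrow> 'k) = ext_deriv K (ext_mult (ext_basis {j}) (ext_basis C))" by simp
  also have "\<dots> = ext_mult (ext_basis {}) (ext_basis C)
      + ext_mult (scl (- 1) (ext_basis {j})) (ext_deriv K (ext_basis C))"
  proof -
    have tw: "(\<lambda>S. (- 1) ^ card S * ext_basis {j} S) = scl (- 1 :: 'k) (ext_basis {j})"
      by (auto simp: ext_basis_def)
    show ?thesis
      unfolding ext_deriv_twisted_Leibniz[OF assms(3)] ext_deriv_basis_singleton[OF assms(3,4)] tw ..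
  qed
  also have "\<dots> = ext_basis C - ext_mult (ext_basis {j}) (ext_deriv K (ext_basis C))"
    unfolding ext_mult_scl_left by (intro ext) (simp add: ext_mult_one_left inf)
  finally show ?thesis by simp
qed

section \<open>The Orlik-Solomon ideal\<close>

locale loopless_matroid = matroid ground indep
  for ground :: "'i::linorder set" and indep +
  assumes loopless: "x \<in> ground \<Longrightarrow> indep {x}"
begin

text \<open>All \<open>e\<^sub>S\<close> occurring in \<open>os_gen T C U\<close> have the same closure, so the ideal is graded by flats.\<close>

definition os_gen :: "'i set \<Rightarrow> 'i set \<Rightarrow> 'i set \<Rightarrow> 'i set \<Rightarrow> 'k::field" where
  "os_gen T C U =
     ext_mult (ext_mult (ext_basis T) (ext_deriv ground (ext_basis C))) (ext_basis U)"

text \<open>Adding one multiple of a generator per step lets properties of the ideal be proved by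
  induction; \<open>OS_ideal_eq_span\<close> makes the identification.\<close>

inductive_set os_span :: "('i set \<Rightarrow> 'k::field) set" where
  zero: "0 \<in> os_span"
| step: "x \<in> os_span \<Longrightarrow> circ C \<Longrightarrow> T \<subseteq> ground \<Longrightarrow> U \<subseteq> ground \<Longrightarrow>
    x + scl c (os_gen T C U) \<in> os_span"

lemma os_span_gen:
  assumes "circ C" "T \<subseteq> ground" "U \<subseteq> ground"
  shows "scl c (os_gen T C U) \<in> os_span"
proof -
  have "0 + scl c (os_gen T C U) \<in> os_span" by (rule os_span.step[OF os_span.zero assms])
  then show ?thesis by simp
qed

lemma os_span_add:
  assumes "x \<in> os_span" "y \<in> os_span"
  shows "x + y \<in> os_span"
  using assms(2)
proof induction
  case zero
  then show ?case using assms(1) by simp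
next
  case (step y C T U c)
  have "x + y + scl c (os_gen T C U) \<in> os_span"
    by (rule os_span.step[OF step.IH step.hyps(2-4)])
  then show ?case by (simp only: add.assoc)
qed

lemma os_span_scl:
  assumes "x \<in> (os_span :: ('i set \<Rightarrow> 'k::field) set)"
  shows "scl d x \<in> os_span"
  using assms
proof induction
  case zero
  have "scl d (0 :: 'i set \<Rightarrow> 'k) = 0" by (rule ext) simp
  then show ?case using os_span.zero by metis
next
  case (step x C T U c)
  have "scl d x + scl (d * c) (os_gen T C U) \<in> os_span"
    by (rule os_span.step[OF step.IH step.hyps(2-4)])
  moreover have "scl d (x + scl c (os_gen T C U)) = scl d x + scl (d * c) (os_gen T C U)"
    by (rule ext) (simp add: algebra_simps)
  ultimately show ?case by simp
qed

lemma os_span_uminus: "x \<in> os_span \<Longrightarrow> - x \<in> os_span"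
  using os_span_scl[of x "- 1"] by (simp add: fun_Compl_def)

lemma os_span_diff: "x \<in> os_span \<Longrightarrow> y \<in> os_span \<Longrightarrow> x - y \<in> os_span"
  using os_span_add[of x "- y"] os_span_uminus[of y] by simp

lemma os_span_sum: "(\<And>a. a \<in> A \<Longrightarrow> f a \<in> os_span) \<Longrightarrow> (\<Sum>a\<in>A. f a) \<in> os_span"
proof (induction A rule: infinite_finite_induct)
  case (insert a A)
  then have "f a + (\<Sum>a\<in>A. f a) \<in> os_span" by (intro os_span_add) auto
  then show ?case unfolding sum.insert[OF insert.hyps] .
qed (simp_all only: sum.infinite sum.empty os_span.zero not_False_eq_True)

lemma circ_deriv_support:
  assumes "circ C" "ext_deriv ground (ext_basis C) S \<noteq> (0 :: 'k::field)"
  shows "\<exists>j\<in>C. S = C - {j}"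
proof -
  obtain i where i: "i \<in> ground - S" "ext_basis C (insert i S) \<noteq> (0 :: 'k)"
    using ext_deriv_support[OF assms(2)] by blast
  then have "insert i S = C" by (auto simp: ext_basis_def split: if_splits)
  then show ?thesis using i by (intro bexI[of _ i]) auto
qed

lemma os_gen_support:
  assumes "circ C" "os_gen T C U S \<noteq> (0 :: 'k::field)"
  shows "\<exists>j\<in>C. S = T \<union> (C - {j}) \<union> U"
proof -
  obtain S1 where S1: "S1 \<subseteq> S" "ext_basis U (S - S1) \<noteq> (0 :: 'k)"
    "ext_mult (ext_basis T) (ext_deriv ground (ext_basis C)) S1 \<noteq> (0 :: 'k)"
    using ext_mult_support[OF assms(2)[unfolded os_gen_def]] by blast
  obtain S2 where S2: "S2 \<subseteq> S1" "ext_basis T S2 \<noteq> (0 :: 'k)"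
    "ext_deriv ground (ext_basis C) (S1 - S2) \<noteq> (0 :: 'k)"
    using ext_mult_support[OF S1(3)] by blast
  have "S2 = T" "S - S1 = U" using S1(2) S2(2) by (auto simp: ext_basis_def split: if_splits)
  moreover obtain j where "j \<in> C" "S1 - S2 = C - {j}" using circ_deriv_support[OF assms(1) S2(3)] by blast
  ultimately show ?thesis using S1(1) S2(1) by blast
qed

lemma cl_os_gen_support:
  assumes "circ C" "T \<subseteq> ground" "U \<subseteq> ground" "os_gen T C U S \<noteq> (0 :: 'k::field)"
  shows "S \<subseteq> ground" "cl S = cl (T \<union> C \<union> U)"
proof -
  obtain j where j: "j \<in> C" "S = T \<union> (C - {j}) \<union> U" using os_gen_support[OF assms(1,4)] by blast
  show "S \<subseteq> ground" using j assms circ_subset_ground[OF assms(1)] by blast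
  have "S = (T \<union> U) \<union> (C - {j})" "T \<union> C \<union> U = (T \<union> U) \<union> C" using j by auto
  then show "cl S = cl (T \<union> C \<union> U)" using cl_Un_circ_Diff[OF assms(1), of "T \<union> U" j] assms by simp
qed

lemma os_span_support:
  assumes "x \<in> (os_span :: ('i set \<Rightarrow> 'k::field) set)" "x S \<noteq> 0"
  shows "S \<subseteq> ground"
  using assms
proof (induction rule: os_span.induct)
  case (step x C T U c)
  show ?case
  proof (cases "x S = 0")
    case True
    then have "os_gen T C U S \<noteq> (0 :: 'k)" using step.prems by auto
    then show ?thesis by (rule cl_os_gen_support(1)[OF step.hyps(2-4)])
  qed (rule step.IH)
qed simp

lemma os_span_basis_mult_left:
  assumes "x \<in> os_span" "A \<subseteq> ground"
  shows "ext_mult (ext_basis A) x \<in> (os_span :: ('i set \<Rightarrow> 'k::field) set)"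
  using assms(1)
proof induction
  case zero
  then show ?case by (simp only: ext_mult_zero_right os_span.zero)
next
  case (step x C T U c)
  have fin: "finite A" "finite T" 
    using finite_subset[OF _ finite_ground] assms(2) step.hyps(3,4) by auto
  \<comment> \<open>A product of two monomials is a signed monomial, or zero when they overlap, so
    the generator passes to a multiple of another one.\<close>
  define d :: 'k where "d = (if A \<inter> T = {} then ext_sign A T else 0)"
  have "ext_mult (ext_basis A) (ext_basis T) = scl d (ext_basis (A \<union> T))"
    by (rule ext) (simp add: ext_basis_mult fin d_def)
  then have "ext_mult (ext_basis A) (os_gen T C U) = scl d (os_gen (A \<union> T) C U)"
    by (simp add: os_gen_def ext_mult_scl_left flip: ext_mult_assoc)
  then have eq: "ext_mult (ext_basis A) (x + scl c (os_gen T C U)) =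
      ext_mult (ext_basis A) x + scl (c * d) (os_gen (A \<union> T) C U)"
    by (simp add: ext_mult_add_right ext_mult_scl_right mult.assoc)
  show ?case unfolding eq by (rule os_span.step[OF step.IH step.hyps(2)]) (use step.hyps assms in auto)
qed

lemma os_span_basis_mult_right:
  assumes "x \<in> os_span" "A \<subseteq> ground"
  shows "ext_mult x (ext_basis A) \<in> (os_span :: ('i set \<Rightarrow> 'k::field) set)"
  using assms(1)
proof induction
  case zero
  then show ?case by (simp only: ext_mult_zero_left os_span.zero)
next
  case (step x C T U c)
  have fin: "finite A" "finite U" 
    using finite_subset[OF _ finite_ground] assms(2) step.hyps(3,4) by auto
  define d :: 'k where "d = (if U \<inter> A = {} then ext_sign U A else 0)"
  have "ext_mult (ext_basis U) (ext_basis A) = scl d (ext_basis (U \<union> A))"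
    by (rule ext) (simp add: ext_basis_mult fin d_def)
  then have "ext_mult (os_gen T C U) (ext_basis A) = scl d (os_gen T C (U \<union> A))"
    by (simp add: os_gen_def ext_mult_scl_right ext_mult_assoc)
  then have eq: "ext_mult (x + scl c (os_gen T C U)) (ext_basis A) =
      ext_mult x (ext_basis A) + scl (c * d) (os_gen T C (U \<union> A))"
    by (simp add: ext_mult_add_left ext_mult_scl_left mult.assoc)
  show ?case unfolding eq by (rule os_span.step[OF step.IH step.hyps(2)]) (use step.hyps assms in auto)
qed

lemma os_span_mult_left:
  assumes "x \<in> os_span" "\<And>S. a S \<noteq> 0 \<Longrightarrow> S \<subseteq> ground"
  shows "ext_mult a x \<in> os_span"
proof -
  have "ext_mult a x = (\<Sum>A\<in>Pow ground. scl (a A) (ext_mult (ext_basis A) x))"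
    by (subst ext_basis_expand[OF finite_ground assms(2)])
      (simp_all add: ext_mult_sum_left ext_mult_scl_left)
  also have "\<dots> \<in> os_span"
    by (intro os_span_sum os_span_scl os_span_basis_mult_left) (use assms in auto)
  finally show ?thesis .
qed

lemma os_span_mult_right:
  assumes "x \<in> os_span" "\<And>S. a S \<noteq> 0 \<Longrightarrow> S \<subseteq> ground"
  shows "ext_mult x a \<in> os_span"
proof -
  have "ext_mult x a = (\<Sum>A\<in>Pow ground. scl (a A) (ext_mult x (ext_basis A)))"
    by (subst ext_basis_expand[OF finite_ground assms(2)])
      (simp_all add: ext_mult_sum_right ext_mult_scl_right)
  also have "\<dots> \<in> os_span"
    by (intro os_span_sum os_span_scl os_span_basis_mult_right) (use assms in auto)
  finally show ?thesis .
qed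

lemma os_span_mult_vec:
  assumes "x \<in> os_span" "X \<subseteq> ground"
  shows "ext_mult x (ext_vec X v) \<in> os_span"
  by (rule os_span_mult_right[OF assms(1)]) (use assms(2) ext_vec_support in blast)

lemma os_span_deriv_basis:
  assumes "circ C"
  shows "ext_deriv ground (ext_basis C) \<in> (os_span :: ('i set \<Rightarrow> 'k::field) set)"
proof -
  have inf: "ext_deriv ground (ext_basis C) U = (0 :: 'k)" if "infinite U" for U
    using circ_deriv_support[OF assms, of U] that circ_subset_ground[OF assms] finite_ground
    by (metis finite_Diff finite_subset)
  have "ext_deriv ground (ext_basis C) = (os_gen {} C {} :: _ \<Rightarrow> 'k)"
    by (simp add: os_gen_def ext_mult_one_left ext_mult_one_right inf)
  also have "\<dots> = scl 1 (os_gen {} C {})" by simp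
  finally show ?thesis using os_span_gen[OF assms, of "{}" "{}" "1::'k"] by simp
qed

text \<open>The span is itself a two-sided ideal containing the generators, hence contains the
  generated ideal; conversely each term is a generator multiplied on both sides by ring
  elements.\<close>

lemma OS_ideal_eq_span: "OS_ideal ground indep = (os_span :: ('i set \<Rightarrow> 'k::field) set)"
proof -
  let ?E = "ext_alg ground :: ('i set \<Rightarrow> 'k) ring"
  let ?A = "{ext_deriv ground (ext_basis C) | C. circ C} :: ('i set \<Rightarrow> 'k) set"
  interpret E: ring ?E by (rule ext_alg_ring[OF finite_ground])
  have car: "x \<in> carrier ?E \<longleftrightarrow> (\<forall>S. x S \<noteq> 0 \<longrightarrow> S \<subseteq> ground)" for x :: "'i set \<Rightarrow> 'k"
    by (simp add: ext_alg_def)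
  have sub: "os_span \<subseteq> carrier ?E" 
  proof
    fix x :: "'i set \<Rightarrow> 'k" assume "x \<in> os_span"
    then show "x \<in> carrier ?E" unfolding car using os_span_support[of x] by simp
  qed
  have ops: "x \<oplus>\<^bsub>?E\<^esub> y = x + y" "x \<otimes>\<^bsub>?E\<^esub> y = ext_mult x y" "\<zero>\<^bsub>?E\<^esub> = 0" for x y
    by (auto simp: ext_alg_def)
  have "ideal os_span ?E"
  proof (rule idealI)
    show "subgroup os_span (add_monoid ?E)"
    proof (rule group.subgroupI)
      show "group (add_monoid ?E)" by (rule E.a_group)
      show "os_span \<subseteq> carrier (add_monoid ?E)" using sub by simp
      show "os_span \<noteq> ({} :: ('i set \<Rightarrow> 'k) set)" using os_span.zero by blast
      fix a b :: "'i set \<Rightarrow> 'k" assume a: "a \<in> os_span" and b: "b \<in> os_span"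
      show "a \<otimes>\<^bsub>add_monoid ?E\<^esub> b \<in> os_span" using os_span_add[OF a b] by (simp add: ops)
    next
      fix a :: "'i set \<Rightarrow> 'k" assume a: "a \<in> os_span"
      have "- a \<in> carrier ?E" using os_span_uminus[OF a] sub by blast
      then have "\<ominus>\<^bsub>?E\<^esub> a = - a" using a sub by (intro E.minus_equality) (auto simp: ops)
      then show "inv\<^bsub>add_monoid ?E\<^esub> a \<in> os_span" using os_span_uminus[OF a] by (simp add: a_inv_def)
    qed
  next
    fix a x :: "'i set \<Rightarrow> 'k" assume a: "a \<in> os_span" and "x \<in> carrier ?E"
    then have x: "\<And>S. x S \<noteq> 0 \<Longrightarrow> S \<subseteq> ground" by (simp add: car)
    show "x \<otimes>\<^bsub>?E\<^esub> a \<in> os_span" unfolding ops by (rule os_span_mult_left[OF a x])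
    show "a \<otimes>\<^bsub>?E\<^esub> x \<in> os_span" unfolding ops by (rule os_span_mult_right[OF a x])
  qed (rule E.ring_axioms)
  moreover have "?A \<subseteq> os_span" using os_span_deriv_basis by blast
  ultimately have 1: "Idl\<^bsub>?E\<^esub> ?A \<subseteq> os_span" by (rule E.genideal_minimal)
  have A: "?A \<subseteq> carrier ?E" using \<open>?A \<subseteq> os_span\<close> sub by blast
  interpret I: ideal "Idl\<^bsub>?E\<^esub> ?A" ?E by (rule E.genideal_ideal[OF A])
  have "x \<in> Idl\<^bsub>?E\<^esub> ?A" if "x \<in> os_span" for x
    using that
  proof induction
    case zero
    show ?case using I.zero_closed unfolding ops(3) .
  next
    case (step x C T U c)
    have b: "ext_basis V \<in> carrier ?E" "scl c (ext_basis V) \<in> carrier ?E" if "V \<subseteq> ground" for V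
      using that by (auto simp: car ext_basis_def)
    have d: "ext_deriv ground (ext_basis C) \<in> Idl\<^bsub>?E\<^esub> ?A"
      using E.genideal_self[OF A] step.hyps(2) by blast
    \<comment> \<open>The scalar is absorbed into the right factor, since an ideal of the ring is
      closed under multiplication by ring elements only.\<close>
    have "ext_mult (ext_mult (ext_basis T) (ext_deriv ground (ext_basis C))) (scl c (ext_basis U))
        \<in> Idl\<^bsub>?E\<^esub> ?A"
      using I.I_r_closed[OF I.I_l_closed[OF d b(1)[OF step.hyps(3)]] b(2)[OF step.hyps(4)]]
      unfolding ops .
    then have "scl c (os_gen T C U) \<in> Idl\<^bsub>?E\<^esub> ?A" by (simp add: os_gen_def ext_mult_scl_right)
    from I.a_closed[OF step.IH this] show ?case unfolding ops(1) .
  qed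
  then show ?thesis using 1 unfolding OS_ideal_def by blast
qed

text \<open>For a circuit \<open>C\<close> inside \<open>S\<close> and \<open>j\<close> in
  \<open>C\<close>, e_C = e_j \<partial>(e_C) is in the ideal, and e_S is up to sign a multiple of
  e_C.\<close>

lemma os_span_dependent_basis:
  assumes "S \<subseteq> ground" "\<not> indep S"
  shows "ext_basis S \<in> (os_span :: ('i set \<Rightarrow> 'k::field) set)"
proof -
  obtain C where C: "C \<subseteq> S" "circ C" using dep_contains_circ[OF assms] by blast
  obtain j where j: "j \<in> C" using circ_nonempty[OF C(2)] by blast
  have fin: "finite C" "finite (S - C)"
    using finite_subset[OF assms(1) finite_ground] C(1) finite_subset by auto
  have jg: "j \<in> ground" using j C assms by blast
  let ?g = "ext_mult (ext_mult (ext_basis {j}) (ext_deriv ground (ext_basis C))) (ext_basis (S - C)) :: 'i set \<Rightarrow> 'k"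
  have "?g = ext_mult (ext_basis C) (ext_basis (S - C))"
    using mult_basis_deriv_basis[OF fin(1) j finite_ground jg, where 'k = 'k] by simp
  also have "\<dots> = scl (ext_sign C (S - C)) (ext_basis S)"
    using C(1) by (intro ext) (simp add: ext_basis_mult fin Un_absorb1)
  finally have g: "?g = scl (ext_sign C (S - C)) (ext_basis S :: _ \<Rightarrow> 'k)" .
  have "?g \<in> (os_span :: ('i set \<Rightarrow> 'k) set)"
    by (rule os_span_mult_right[OF os_span_mult_left[OF os_span_deriv_basis[OF C(2)]]])
      (use jg assms(1) in \<open>auto simp: ext_basis_def split: if_splits\<close>)
  then have "scl (ext_sign C (S - C)) (scl (ext_sign C (S - C)) (ext_basis S :: _ \<Rightarrow> 'k)) \<in> os_span"
    unfolding g by (rule os_span_scl)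
  moreover have "scl (ext_sign C (S - C)) (scl (ext_sign C (S - C)) (ext_basis S)) = (ext_basis S :: _ \<Rightarrow> 'k)"
    by (simp add: ext_sign_square flip: mult.assoc)
  ultimately show ?thesis by simp
qed

lemma os_span_if_dependent_support:
  assumes "\<And>S. x S \<noteq> 0 \<Longrightarrow> S \<subseteq> ground \<and> \<not> indep S"
  shows "x \<in> os_span"
proof -
  have "scl (x A) (ext_basis A) \<in> os_span" if "A \<in> Pow ground" for A
  proof (cases "x A = 0")
    case True
    then have "scl (x A) (ext_basis A) = 0" by (intro ext) simp
    then show ?thesis using os_span.zero by metis
  next
    case False
    then show ?thesis using assms[OF False] by (intro os_span_scl os_span_dependent_basis) auto
  qed
  then have "(\<Sum>A\<in>Pow ground. scl (x A) (ext_basis A)) \<in> os_span" by (rule os_span_sum)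
  moreover have "x = (\<Sum>A\<in>Pow ground. scl (x A) (ext_basis A))"
    by (rule ext_basis_expand[OF finite_ground]) (use assms in blast)
  ultimately show ?thesis by (simp only:)
qed

text \<open>The projection onto those summands of the grading by flats (the Brieskorn decomposition)
  whose flat satisfies \<open>R\<close>.\<close>

definition cl_part :: "('i set \<Rightarrow> bool) \<Rightarrow> ('i set \<Rightarrow> 'k::field) \<Rightarrow> 'i set \<Rightarrow> 'k" where
  "cl_part R x = (\<lambda>S. if R (cl S) then x S else 0)"

lemma cl_part_add: "cl_part R (x + y) = cl_part R x + cl_part R y"
  by (rule ext) (simp add: cl_part_def)

lemma cl_part_diff: "cl_part R (x - y) = cl_part R x - cl_part R y"
  by (rule ext) (simp add: cl_part_def)

lemma cl_part_scl: "cl_part R (scl c x) = scl c (cl_part R x)"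
  by (rule ext) (simp add: cl_part_def)

lemma cl_part_os_gen:
  assumes "circ C" "T \<subseteq> ground" "U \<subseteq> ground"
  shows "cl_part R (os_gen T C U) = (if R (cl (T \<union> C \<union> U)) then os_gen T C U else 0)"
proof
  fix S
  show "cl_part R (os_gen T C U) S = (if R (cl (T \<union> C \<union> U)) then os_gen T C U else 0) S"
    using cl_os_gen_support(2)[OF assms, of S, where 'k = 'b]
    by (cases "os_gen T C U S = (0 :: 'b)") (auto simp: cl_part_def)
qed

text \<open>Each generator lives over a single flat, so the projection multiplies it by 1 or
  0.\<close>

lemma os_span_cl_part:
  assumes "x \<in> (os_span :: ('i set \<Rightarrow> 'k::field) set)"
  shows "cl_part R x \<in> os_span"
  using assms
proof induction
  case zero
  have "cl_part R (0 :: 'i set \<Rightarrow> 'k) = 0" by (rule ext) (simp add: cl_part_def)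
  then show ?case using os_span.zero by metis
next
  case (step x C T U c)
  have "cl_part R (os_gen T C U) = scl (if R (cl (T \<union> C \<union> U)) then 1 else 0) (os_gen T C U)"
    unfolding cl_part_os_gen[OF step.hyps(2-4)] by (intro ext) simp
  from fun_cong[OF this] have h: "cl_part R (os_gen T C U) S =
      (if R (cl (T \<union> C \<union> U)) then 1 else 0) * os_gen T C U S" for S .
  have eq: "cl_part R (x + scl c (os_gen T C U)) =
      cl_part R x + scl (c * (if R (cl (T \<union> C \<union> U)) then 1 else 0)) (os_gen T C U)"
    unfolding cl_part_add cl_part_scl by (rule ext) (simp add: h)
  show ?case unfolding eq by (rule os_span.step[OF step.IH step.hyps(2-4)])
qed

section \<open>The contracting homotopy over a flat\<close>

lemma closed_subset_ground: "cl X = X \<Longrightarrow> X \<subseteq> ground"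
  using cl_subset_ground[of X] by simp

lemma closed_finite: "cl X = X \<Longrightarrow> finite X"
  using finite_subset[OF closed_subset_ground finite_ground] .

lemma cl_empty: "cl {} = {}"
proof -
  have "x \<notin> cl {}" for x
    using mem_cl_basis[OF subset_refl indep_empty rk_eq_card_indep[OF indep_empty, symmetric], of x]
      loopless[of x] by simp
  then show ?thesis by blast
qed

text \<open>By Leibniz it suffices that the derivation kills \<partial>(e_C). Projecting to flats
  inside \<open>X\<close> first discards generators with circuits not contained in \<open>X\<close>,
  about which \<open>sep\<close> says nothing.\<close>

lemma os_span_deriv:
  assumes X: "cl X = X" and K: "K \<subseteq> X"
    and sep: "\<And>C. circ C \<Longrightarrow> C \<subseteq> X \<Longrightarrow> C \<subseteq> K \<or> C \<inter> K = {}"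
    and x: "x \<in> (os_span :: ('i set \<Rightarrow> 'k::field) set)"
  shows "ext_deriv K (cl_part (\<lambda>Y. Y \<subseteq> X) x) \<in> os_span"
  using x
proof induction
  case zero
  have "cl_part (\<lambda>Y. Y \<subseteq> X) (0 :: 'i set \<Rightarrow> 'k) = 0" by (rule ext) (simp add: cl_part_def)
  then have eq: "ext_deriv K (cl_part (\<lambda>Y. Y \<subseteq> X) (0 :: 'i set \<Rightarrow> 'k)) = 0" by (simp only: ext_deriv_zero)
  show ?case unfolding eq by (rule os_span.zero)
next
  case (step x C T U c)
  have Kf: "finite K" "K \<subseteq> ground"
    using K closed_finite[OF X] closed_subset_ground[OF X] finite_subset by auto
  let ?gs = "T \<union> C \<union> U"
  have gs: "?gs \<subseteq> ground" using step.hyps(2-4) circ_subset_ground by auto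
  have g: "ext_deriv K (cl_part (\<lambda>Y. Y \<subseteq> X) (os_gen T C U)) \<in> (os_span :: ('i set \<Rightarrow> 'k) set)"
  proof (cases "cl ?gs \<subseteq> X")
    case False
    then have eq: "cl_part (\<lambda>Y. Y \<subseteq> X) (os_gen T C U) = (0 :: 'i set \<Rightarrow> 'k)"
      unfolding cl_part_os_gen[OF step.hyps(2-4)] by simp
    show ?thesis unfolding eq ext_deriv_zero by (rule os_span.zero)
  next
    case True
    then have eq: "cl_part (\<lambda>Y. Y \<subseteq> X) (os_gen T C U) = (os_gen T C U :: 'i set \<Rightarrow> 'k)"
      unfolding cl_part_os_gen[OF step.hyps(2-4)] by simp
    have "C \<subseteq> X" using cl_extensive[OF gs] True by blast
    let ?d = "ext_deriv ground (ext_basis C) :: 'i set \<Rightarrow> 'k"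
    \<comment> \<open>If \<open>C\<close> lies in \<open>K\<close>, the derivation is applied twice
      to e_C; if \<open>C\<close> misses \<open>K\<close>, no monomial of \<partial>(e_C) involves
      an index of \<open>K\<close>.\<close>
    have "ext_deriv K ?d = 0"
    proof (cases "C \<subseteq> K")
      case True
      have "?d = ext_deriv K (ext_basis C)"
        by (rule ext_deriv_basis_cong) (use Kf finite_ground True in auto)
      moreover have "ext_basis C V = (0 :: 'k)" if "infinite V" for V
        using that finite_subset[OF True Kf(1)] by (auto simp: ext_basis_def)
      ultimately show ?thesis using ext_deriv_deriv[OF Kf(1), of "ext_basis C :: 'i set \<Rightarrow> 'k"] by simp
    next
      case False
      then have disj: "C \<inter> K = {}" using sep[OF step.hyps(2) \<open>C \<subseteq> X\<close>] by blast
      show ?thesis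
      proof (rule ext, rule ccontr)
        fix S assume "ext_deriv K ?d S \<noteq> 0 S"
        then have "ext_deriv K ?d S \<noteq> 0" by simp
        then obtain i where i: "i \<in> K - S" "?d (insert i S) \<noteq> 0" using ext_deriv_support by blast
        then show False using circ_deriv_support[OF step.hyps(2) i(2)] disj by blast
      qed
    qed
    then have dd: "ext_deriv K (ext_mult (ext_basis T) ?d) =
        ext_mult (ext_deriv K (ext_basis T)) ?d"
      unfolding ext_deriv_twisted_Leibniz[OF Kf(1)] by simp
    have d: "?d \<in> os_span" by (rule os_span_deriv_basis[OF step.hyps(2)])
    have Tsup: "S \<subseteq> ground" if "ext_deriv K (ext_basis T) S \<noteq> (0 :: 'k)" for S
      using ext_deriv_support[OF that] step.hyps(3) by (auto simp: ext_basis_def split: if_splits)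
    have Usup: "S \<subseteq> ground" if "ext_deriv K (ext_basis U) S \<noteq> (0 :: 'k)" for S
      using ext_deriv_support[OF that] step.hyps(4) by (auto simp: ext_basis_def split: if_splits)
    have Td: "ext_mult (ext_basis T) ?d \<in> os_span"
      by (rule os_span_basis_mult_left[OF d step.hyps(3)])
    define tw where "tw = (\<lambda>S. (- 1) ^ card S * ext_mult (ext_basis T) ?d S)"
    \<comment> \<open>All monomials of this product have the same degree, so the Leibniz sign is a
      constant; the subtraction is exact because a circuit is nonempty.\<close>
    have tw: "tw = scl ((- 1) ^ (card T + (card C - 1))) (ext_mult (ext_basis T) ?d)"
    proof
      fix S
      show "tw S = scl ((- 1) ^ (card T + (card C - 1))) (ext_mult (ext_basis T) ?d) S"
      proof (cases "ext_mult (ext_basis T) ?d S = 0")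
        case False
        obtain A where A: "A \<subseteq> S" "ext_basis T A \<noteq> (0 :: 'k)" "?d (S - A) \<noteq> 0"
          using ext_mult_support[OF False] by blast
        have "A = T" using A(2) by (simp add: ext_basis_def split: if_splits)
        moreover obtain j where j: "j \<in> C" "S - A = C - {j}"
          using circ_deriv_support[OF step.hyps(2) A(3)] by blast
        moreover have "finite C" "finite T"
          using finite_subset[OF _ finite_ground] gs by auto
        moreover have "card S = card A + card (S - A)"
          using A(1) j(2) calculation
          by (metis card_Un_disjoint Diff_disjoint Un_Diff_cancel Un_absorb1 finite_Diff)
        ultimately have "card S = card T + (card C - 1)" by simp
        then show ?thesis by (simp add: tw_def)
      qed (simp add: tw_def)
    qed
    have "ext_deriv K (os_gen T C U) =
        ext_mult (ext_mult (ext_deriv K (ext_basis T)) ?d) (ext_basis U)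
        + ext_mult tw (ext_deriv K (ext_basis U))"
      unfolding os_gen_def ext_deriv_twisted_Leibniz[OF Kf(1), of "ext_mult (ext_basis T) ?d"] dd tw_def ..
    moreover have "ext_mult (ext_mult (ext_deriv K (ext_basis T)) ?d) (ext_basis U) \<in> os_span"
      by (rule os_span_basis_mult_right[OF os_span_mult_left[OF d Tsup] step.hyps(4)])
    moreover have "ext_mult tw (ext_deriv K (ext_basis U)) \<in> os_span"
      unfolding tw by (rule os_span_mult_right[OF os_span_scl[OF Td] Usup])
    ultimately show ?thesis unfolding eq by (simp only: os_span_add)
  qed
  have eq: "ext_deriv K (cl_part (\<lambda>Y. Y \<subseteq> X) (x + scl c (os_gen T C U))) =
     ext_deriv K (cl_part (\<lambda>Y. Y \<subseteq> X) x) + scl c (ext_deriv K (cl_part (\<lambda>Y. Y \<subseteq> X) (os_gen T C U)))"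
    unfolding cl_part_add cl_part_scl ext_deriv_add ext_deriv_scl ..
  show ?case unfolding eq by (rule os_span_add[OF step.IH os_span_scl[OF g]])
qed

text \<open>The degree is an integer so that \<open>q - 1\<close> makes sense for \<open>q = 0\<close>: only \<open>0\<close> has degree \<open>- 1\<close>.\<close>

definition homog :: "'i set \<Rightarrow> int \<Rightarrow> ('i set \<Rightarrow> 'k::field) \<Rightarrow> bool" where
  "homog X q x \<longleftrightarrow> (\<forall>S. x S \<noteq> 0 \<longrightarrow> S \<subseteq> X \<and> int (card S) = q)"

lemma homog_mult_vec:
  assumes "homog X q x" "X \<subseteq> Z" "Y \<subseteq> Z" "finite Z"
  shows "homog Z (q + 1) (ext_mult x (ext_vec Y v))"
  unfolding homog_def
proof (intro allI impI)
  fix U assume "ext_mult x (ext_vec Y v) U \<noteq> 0"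
  then obtain j where j: "j \<in> U \<inter> Y" "x (U - {j}) \<noteq> 0" using mult_vec_support by blast
  then have U: "U - {j} \<subseteq> X" "int (card (U - {j})) = q"
    using assms(1) unfolding homog_def by blast+
  then have "U \<subseteq> Z" using j assms by blast
  then have "finite U" using assms(4) by (rule finite_subset)
  then have "card U = Suc (card (U - {j}))" using card_Suc_Diff1[of U j] j(1) by simp
  then show "U \<subseteq> Z \<and> int (card U) = q + 1" using U \<open>U \<subseteq> Z\<close> by simp
qed

lemma homog_mult_vec_same:
  assumes "cl X = X" "homog X q x"
  shows "homog X (q + 1) (ext_mult x (ext_vec X v))"
  by (rule homog_mult_vec[OF assms(2) order_refl order_refl closed_finite[OF assms(1)]])

lemma homog_scl: "homog X q x \<Longrightarrow> homog X q (scl c x)"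
  by (auto simp: homog_def)

lemma homog_add: "homog X q x \<Longrightarrow> homog X q y \<Longrightarrow> homog X q (x + y)"
  unfolding homog_def plus_fun_apply by (metis add.right_neutral)

lemma homog_uminus: "homog X q x \<Longrightarrow> homog X q (- x)"
  by (simp add: homog_def)

lemma homog_deriv:
  assumes "homog X q x" "K \<subseteq> X" "finite X"
  shows "homog X (q - 1) (ext_deriv K x)"
  unfolding homog_def
proof (intro allI impI)
  fix S assume "ext_deriv K x S \<noteq> 0"
  then obtain i where i: "i \<in> K - S" "x (insert i S) \<noteq> 0" using ext_deriv_support by blast
  then have S: "insert i S \<subseteq> X" "int (card (insert i S)) = q"
    using assms(1) unfolding homog_def by blast+
  then have "finite S" using finite_subset[OF _ assms(3), of S] by simp
  then show "S \<subseteq> X \<and> int (card S) = q - 1" using S i(1) by auto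
qed

lemma cl_part_subset_eq:
  assumes "cl X = X" "\<And>S. x S \<noteq> 0 \<Longrightarrow> S \<subseteq> X"
  shows "cl_part (\<lambda>Y. Y \<subseteq> X) x = x"
proof
  fix S
  show "cl_part (\<lambda>Y. Y \<subseteq> X) x S = x S"
    using cl_minimal[OF assms(2) assms(1), of S] by (auto simp: cl_part_def)
qed

text \<open>Differentiating x v along \<open>K\<close> gives (\<partial>x) v plus or minus v_K x.
  The left side is in the ideal together with x v, and v_K can be divided out.\<close>

lemma homotopy:
  assumes X: "cl X = X" and K: "K \<subseteq> X"
    and sep: "\<And>C. circ C \<Longrightarrow> C \<subseteq> X \<Longrightarrow> C \<subseteq> K \<or> C \<inter> K = {}"
    and v: "(\<Sum>j\<in>K. v j) \<noteq> 0"
    and x: "homog X q x" and cocycle: "ext_mult x (ext_vec X v) \<in> os_span"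
  shows "\<exists>w. homog X (q - 1) w \<and> x - ext_mult w (ext_vec X v) \<in> (os_span :: ('i set \<Rightarrow> 'k::field) set)"
proof -
  have fin: "finite X" "finite K" using closed_finite[OF X] K finite_subset by auto
  define s where "s = (\<Sum>j\<in>K. v j)"
  \<comment> \<open>The sign (-1)^q; for negative \<open>q\<close> the element \<open>x\<close> is
    zero and the value is irrelevant.\<close>
  define e where "e = ((- 1) ^ nat q :: 'k)"
  have e: "e * e = 1" by (simp add: e_def flip: power_mult_distrib)
  let ?y = "ext_mult x (ext_vec X v)"
  have supp: "S \<subseteq> X" if "x S \<noteq> 0" for S using x that by (simp add: homog_def)
  have "cl_part (\<lambda>Y. Y \<subseteq> X) ?y = ?y"
    using homog_mult_vec_same[OF X x, of v] by (intro cl_part_subset_eq[OF X]) (simp add: homog_def)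
  then have Dy: "ext_deriv K ?y \<in> os_span" using os_span_deriv[OF X K sep cocycle] by simp
  have tw: "(\<lambda>S. (- 1) ^ card S * x S) = scl e x"
  proof
    fix S show "(- 1) ^ card S * x S = e * x S"
      using x by (cases "x S = 0") (auto simp: e_def homog_def)
  qed
  have "x U = 0" if "infinite U" for U using supp[of U] that fin finite_subset by blast
  then have one: "ext_mult x (ext_basis {}) = x" by (rule ext_mult_one_right)
  have "ext_deriv K ?y = ext_mult (ext_deriv K x) (ext_vec X v) + scl e (scl s x)"
    unfolding ext_deriv_twisted_Leibniz[OF fin(2)] tw ext_deriv_vec[OF fin(1) K] s_def[symmetric]
      ext_mult_scl_left ext_mult_scl_right one ..
  from fun_cong[OF this]
  have eq: "ext_deriv K ?y S = ext_mult (ext_deriv K x) (ext_vec X v) S + e * (s * x S)" for S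
    by simp
  \<comment> \<open>Obtained by solving the formula for \<open>ext_deriv K ?y\<close> for
    \<open>x\<close>, using e * e = 1.\<close>
  define w where "w = scl (- (e / s)) (ext_deriv K x)"
  have "x - ext_mult w (ext_vec X v) = scl (e / s) (ext_deriv K ?y)"
    unfolding w_def ext_mult_scl_left
  proof
    fix S
    have "e / s * (e * (s * x S)) = (e * e) * x S" using v by (simp add: s_def)
    then show "(x - scl (- (e / s)) (ext_mult (ext_deriv K x) (ext_vec X v))) S =
        scl (e / s) (ext_deriv K ?y) S"
      unfolding eq using e by (simp add: distrib_left)
  qed
  moreover have "homog X (q - 1) w"
    unfolding w_def by (intro homog_scl homog_deriv[OF x K fin(1)])
  ultimately show ?thesis using os_span_scl[OF Dy, of "e / s"] by auto
qed

subsection \<open>Moving a cocycle off the flats through a point\<close>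

text \<open>Membership in the summand N of the splitting.\<close>

definition avoids :: "'i \<Rightarrow> ('i set \<Rightarrow> 'k::field) \<Rightarrow> bool" where
  "avoids i x \<longleftrightarrow> (\<forall>S. x S \<noteq> 0 \<longrightarrow> i \<notin> cl S)"

text \<open>Modulo the ideal, \<open>w\<close> is a coboundary over \<open>X\<close> plus an element
  of N: surjectivity onto the P-summand. The element \<open>u\<close> is left free, because u v v =
  0 lets it drop out after multiplication by v.\<close>

definition liftable :: "'i \<Rightarrow> ('i \<Rightarrow> 'k::field) \<Rightarrow> 'i set \<Rightarrow> int \<Rightarrow> ('i set \<Rightarrow> 'k) \<Rightarrow> bool" where
  "liftable i v X q w \<longleftrightarrow> (\<exists>u n. homog X (q - 1) u \<and> homog X q n \<and> avoids i n \<and>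
     w - (ext_mult u (ext_vec X v) + n) \<in> os_span)"

lemma liftableI:
  assumes "homog X (q - 1) u" "homog X q n" "avoids i n"
    "w - (ext_mult u (ext_vec X v) + n) \<in> os_span"
  shows "liftable i v X q w"
  using assms unfolding liftable_def by blast

lemma homog_zero: "homog X q 0"
  by (simp add: homog_def)

lemma avoids_zero: "avoids i 0"
  by (simp add: avoids_def)

lemma avoids_add: "avoids i x \<Longrightarrow> avoids i y \<Longrightarrow> avoids i (x + y)"
  unfolding avoids_def plus_fun_apply by (metis add.right_neutral)

lemma avoids_scl: "avoids i x \<Longrightarrow> avoids i (scl c x)"
  by (simp add: avoids_def)

lemma avoids_uminus: "avoids i x \<Longrightarrow> avoids i (- x)"
  by (simp add: avoids_def)

lemma liftable_zero: "liftable i v X q 0"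
  by (rule liftableI[OF homog_zero homog_zero avoids_zero]) (simp add: os_span.zero)

lemma liftable_add:
  assumes "liftable i v X q x" "liftable i v X q y"
  shows "liftable i v X q (x + y)"
proof -
  obtain u n where 1: "homog X (q - 1) u" "homog X q n" "avoids i n"
    "x - (ext_mult u (ext_vec X v) + n) \<in> os_span"
    using assms(1) unfolding liftable_def by blast
  obtain u' n' where 2: "homog X (q - 1) u'" "homog X q n'" "avoids i n'"
    "y - (ext_mult u' (ext_vec X v) + n') \<in> os_span"
    using assms(2) unfolding liftable_def by blast
  show ?thesis
  proof (rule liftableI)
    show "homog X (q - 1) (u + u')" "homog X q (n + n')" "avoids i (n + n')"
      using 1 2 homog_add avoids_add by blast+
    have "x + y - (ext_mult (u + u') (ext_vec X v) + (n + n')) =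
      (x - (ext_mult u (ext_vec X v) + n)) + (y - (ext_mult u' (ext_vec X v) + n'))"
      unfolding ext_mult_add_left by (simp only: add_diff_eq diff_add_eq diff_diff_eq add_ac)
    then show "x + y - (ext_mult (u + u') (ext_vec X v) + (n + n')) \<in> os_span"
      using os_span_add[OF 1(4) 2(4)] by (simp only:)
  qed
qed

lemma liftable_scl:
  assumes "liftable i v X q x"
  shows "liftable i v X q (scl c x)"
proof -
  obtain u n where 1: "homog X (q - 1) u" "homog X q n" "avoids i n"
    "x - (ext_mult u (ext_vec X v) + n) \<in> os_span"
    using assms(1) unfolding liftable_def by blast
  show ?thesis
  proof (rule liftableI[OF homog_scl homog_scl avoids_scl])
    have "scl c x - (ext_mult (scl c u) (ext_vec X v) + scl c n) =
      scl c (x - (ext_mult u (ext_vec X v) + n))"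
      unfolding ext_mult_scl_left by (rule ext) (simp add: algebra_simps)
    then show "scl c x - (ext_mult (scl c u) (ext_vec X v) + scl c n) \<in> os_span"
      using os_span_scl[OF 1(4), of c] by (simp only:)
  qed (rule 1)+
qed

lemma liftable_sum:
  assumes "\<And>a. a \<in> A \<Longrightarrow> liftable i v X q (f a)"
  shows "liftable i v X q (\<Sum>a\<in>A. f a)"
  using assms
proof (induction A rule: infinite_finite_induct)
  case (insert a A)
  have "liftable i v X q (f a + (\<Sum>a\<in>A. f a))"
    by (rule liftable_add[OF _ insert.IH]) (use insert.prems in auto)
  then show ?case unfolding sum.insert[OF insert.hyps] .
qed (simp_all only: sum.infinite sum.empty liftable_zero not_False_eq_True)

text \<open>If adding \<open>j\<close> to \<open>S\<close> brought \<open>i\<close> into the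
  closure, exchange would put \<open>j\<close> into the closure of \<open>insert i S\<close>, hence
  into \<open>Y\<close>. This is the block-diagonality: only the part of v on \<open>Y\<close> feeds
  the P-component.\<close>

lemma mult_vec_outside_avoids:
  assumes Y: "cl Y = Y" "i \<in> Y" and n: "homog Y q n" "avoids i n" and X: "X \<subseteq> ground" "X \<inter> Y = {}"
  shows "avoids i (ext_mult n (ext_vec X v))"
  unfolding avoids_def
proof (intro allI impI)
  fix U assume "ext_mult n (ext_vec X v) U \<noteq> 0"
  then obtain j where j: "j \<in> U \<inter> X" "n (U - {j}) \<noteq> 0" using mult_vec_support by blast
  let ?S = "U - {j}"
  have S: "?S \<subseteq> Y" "i \<notin> cl ?S" using n j(2) by (simp_all only: homog_def avoids_def) blast+
  have U: "U = insert j ?S" using j(1) by blast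
  show "i \<notin> cl U"
  proof
    assume "i \<in> cl U"
    then have "i \<in> cl (insert j ?S)" using U by simp
    moreover have "?S \<subseteq> ground" using S(1) closed_subset_ground[OF Y(1)] by (rule subset_trans)
    moreover have "j \<in> ground" using j(1) X(1) by blast
    ultimately have "j \<in> cl (insert i ?S)" using exchange S(2) by blast
    moreover have "cl (insert i ?S) \<subseteq> Y" by (rule cl_minimal[OF _ Y(1)]) (use S(1) Y(2) in blast)
    ultimately show False using j(1) X(2) by blast
  qed
qed

text \<open>Decompose \<open>x\<close> by flats. A piece containing an independent monomial is a
  further projection of one of the given local parts; any other piece has dependent monomials
  only.\<close>

lemma os_span_if_local:
  assumes x: "\<And>S. x S \<noteq> 0 \<Longrightarrow> S \<subseteq> ground"
    and loc: "\<And>S. x S \<noteq> 0 \<Longrightarrow> indep S \<Longrightarrow>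
      \<exists>Y. cl Y = Y \<and> S \<subseteq> Y \<and> cl_part (\<lambda>Z. Z \<subseteq> Y) x \<in> os_span"
  shows "x \<in> os_span"
proof -
  have eq: "x = (\<Sum>Z\<in>Pow ground. cl_part (\<lambda>W. W = Z) x)"
  proof
    fix S
    have "(\<Sum>Z\<in>Pow ground. cl_part (\<lambda>W. W = Z) x) S = (\<Sum>Z\<in>Pow ground. if cl S = Z then x S else 0)"
      unfolding sum_fun_apply cl_part_def ..
    then show "x S = (\<Sum>Z\<in>Pow ground. cl_part (\<lambda>W. W = Z) x) S"
      using finite_ground cl_subset_ground[of S] by simp
  qed
  have "cl_part (\<lambda>W. W = Z) x \<in> os_span" for Z
  proof (cases "\<exists>S. x S \<noteq> 0 \<and> indep S \<and> cl S = Z")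
    case True
    then obtain S where S: "x S \<noteq> 0" "indep S" "cl S = Z" by blast
    obtain Y where Y: "cl Y = Y" "S \<subseteq> Y" "cl_part (\<lambda>Z. Z \<subseteq> Y) x \<in> os_span" using loc[OF S(1,2)] by blast
    have "Z \<subseteq> Y" using cl_minimal[OF Y(2,1)] S(3) by simp
    then have "cl_part (\<lambda>W. W = Z) x = cl_part (\<lambda>W. W = Z) (cl_part (\<lambda>Z. Z \<subseteq> Y) x)"
      by (intro ext) (simp add: cl_part_def)
    then show ?thesis using os_span_cl_part[OF Y(3), of "\<lambda>W. W = Z"] by (simp only:)
  next
    case False
    show ?thesis
    proof (rule os_span_if_dependent_support)
      fix S assume "cl_part (\<lambda>W. W = Z) x S \<noteq> 0"
      then have "x S \<noteq> 0" "cl S = Z" by (simp_all add: cl_part_def split: if_splits)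
      then show "S \<subseteq> ground \<and> \<not> indep S" using x False by blast
    qed
  qed
  then show ?thesis by (subst eq) (rule os_span_sum)
qed

section \<open>Compatibility of products with restriction to a flat\<close>

lemma ground_closed: "cl ground = ground"
  using cl_extensive[of ground] cl_subset_ground[of ground] by blast

lemma cl_part_mult_vec_ground:
  fixes n :: "'i set \<Rightarrow> 'k::field"
  assumes Y: "cl Y = Y" and n: "\<And>S. n S \<noteq> 0 \<Longrightarrow> S \<subseteq> ground"
  shows "cl_part (\<lambda>Z. Z \<subseteq> Y) (ext_mult n (ext_vec ground v)) =
    ext_mult (cl_part (\<lambda>Z. Z \<subseteq> Y) n) (ext_vec Y v)"
proof
  fix U
  have Yg: "Y \<subseteq> ground" by (rule closed_subset_ground[OF Y])
  \<comment> \<open>For subsets of the ground set, having closure inside the flat \<open>Y\<close>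
    amounts to being a subset of \<open>Y\<close>, so this projection simply restricts the
    support.\<close>
  have part: "cl_part (\<lambda>Z. Z \<subseteq> Y) x S = (if S \<subseteq> Y then x S else 0)"
    if "\<And>S. x S \<noteq> 0 \<Longrightarrow> S \<subseteq> ground" for x :: "'i set \<Rightarrow> 'k" and S
    using that[of S] subset_closed_iff[OF _ Y, of S] by (auto simp: cl_part_def)
  have prod: "S \<subseteq> ground" if "ext_mult n (ext_vec ground v) S \<noteq> 0" for S
    using mult_vec_support[OF that] n by blast
  show "cl_part (\<lambda>Z. Z \<subseteq> Y) (ext_mult n (ext_vec ground v)) U =
    ext_mult (cl_part (\<lambda>Z. Z \<subseteq> Y) n) (ext_vec Y v) U"
  proof (cases "U \<subseteq> Y")
    case True
    have "ext_mult n (ext_vec ground v) U = ext_mult (cl_part (\<lambda>Z. Z \<subseteq> Y) n) (ext_vec Y v) U"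
    proof (rule ext_mult_local)
      fix S assume S: "S \<subseteq> U"
      then show "n S = cl_part (\<lambda>Z. Z \<subseteq> Y) n S" using part[of n S] n True by auto
      show "ext_vec ground v S = ext_vec Y v S"
      proof (cases "\<exists>j. S = {j}")
        case True
        then obtain j where "S = {j}" by blast
        then show ?thesis
          using ext_vec_singleton[OF finite_ground, of v j] ext_vec_singleton[OF closed_finite[OF Y], of v j]
            S \<open>U \<subseteq> Y\<close> Yg by auto
      next
        case False
        then show ?thesis using ext_vec_support[of ground v S] ext_vec_support[of Y v S] by metis
      qed
    qed
    then show ?thesis using part[of "ext_mult n (ext_vec ground v)" U] prod True by simp
  next
    case False
    have "ext_mult (cl_part (\<lambda>Z. Z \<subseteq> Y) n) (ext_vec Y v) U = 0"
    proof (rule ccontr)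
      assume "\<not> ?thesis"
      then obtain j where j: "j \<in> U \<inter> Y" "cl_part (\<lambda>Z. Z \<subseteq> Y) n (U - {j}) \<noteq> 0"
        using mult_vec_support by blast
      then have "U - {j} \<subseteq> Y" using part[of n "U - {j}"] n by (auto split: if_splits)
      then show False using j(1) False by blast
    qed
    then show ?thesis using part[of "ext_mult n (ext_vec ground v)" U] prod False by simp
  qed
qed

lemma cl_part_commute: "cl_part Q (cl_part R x) = cl_part R (cl_part Q x)"
  by (rule ext) (simp add: cl_part_def)

lemma cl_part_avoids: "avoids i x \<Longrightarrow> cl_part (\<lambda>Z. i \<in> Z) x = 0"
  by (rule ext) (auto simp: cl_part_def avoids_def)

section \<open>Surjectivity and injectivity by induction on the degree\<close>

context
  fixes i :: 'i and v :: "'i \<Rightarrow> 'k::field" and p :: nat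
  assumes i: "i \<in> ground"
    and nonres: "\<And>Y. cl Y = Y \<Longrightarrow> i \<in> Y \<Longrightarrow> rk Y \<le> Suc p \<Longrightarrow> (\<Sum>j\<in>component Y i. v j) \<noteq> 0"
begin

lemma local_homotopy:
  assumes "cl Y = Y" "i \<in> Y" "rk Y \<le> Suc p" "homog Y q x" "ext_mult x (ext_vec Y v) \<in> os_span"
  obtains w where "homog Y (q - 1) w" "x - ext_mult w (ext_vec Y v) \<in> os_span"
  using homotopy[OF assms(1) component_subset[OF assms(2)] component_separates nonres[OF assms(1-3)] assms(4,5)]
  by blast

text \<open>On the flat spanned by \<open>S\<close> the local complex is exact, so e_S = w v there.
  The hypothesis in one degree less replaces \<open>w\<close> by an element of N, and the rest of v
  contributes only to N.\<close>

lemma liftable_basis_spanning: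
  assumes IH: "\<And>Y w. cl Y = Y \<Longrightarrow> i \<in> Y \<Longrightarrow> homog Y (int q - 1) w \<Longrightarrow> liftable i v Y (int q - 1) w"
    and X: "cl X = X" "i \<in> X" and S: "indep S" "S \<subseteq> X" "card S = q" "i \<in> cl S" "q \<le> p"
  shows "liftable i v X (int q) (ext_basis S)"
proof -
  define Y where "Y = cl S"
  have Sg: "S \<subseteq> ground" using S(1) by (rule indep_subset_ground)
  have Y: "cl Y = Y" "i \<in> Y" "S \<subseteq> Y" "Y \<subseteq> X" "Y \<subseteq> ground"
    unfolding Y_def using cl_idem[OF Sg] S(4) cl_extensive[OF Sg] cl_minimal[OF S(2) X(1)] cl_subset_ground
    by auto
  have rkY: "rk Y = q" unfolding Y_def using rk_cl[OF Sg] rk_eq_card_indep[OF S(1)] S(3) by simp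
  have hS: "homog Y (int q) (ext_basis S :: 'i set \<Rightarrow> 'k)"
    using Y(3) S(3) by (simp add: homog_def ext_basis_def)
  \<comment> \<open>The degree of e_S equals the rank of \<open>Y\<close>, so the product lies above
    the top degree and only dependent monomials remain.\<close>
  have "ext_mult (ext_basis S) (ext_vec Y v) \<in> os_span"
  proof (rule os_span_if_dependent_support)
    fix U assume "ext_mult (ext_basis S) (ext_vec Y v) U \<noteq> 0"
    then have U: "U \<subseteq> Y" "card U = Suc q"
      using homog_mult_vec_same[OF Y(1) hS, of v] unfolding homog_def by fastforce+
    then show "U \<subseteq> ground \<and> \<not> indep U" using card_le_rk[of U Y] rkY Y(5) by auto
  qed
  then obtain w where w: "homog Y (int q - 1) w" "ext_basis S - ext_mult w (ext_vec Y v) \<in> os_span"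
    using local_homotopy[OF Y(1,2) _ hS] rkY S(5) by auto
  obtain u n where un: "homog Y (int q - 1 - 1) u" "homog Y (int q - 1) n" "avoids i n"
    "w - (ext_mult u (ext_vec Y v) + n) \<in> os_span"
    using IH[OF Y(1,2) w(1)] unfolding liftable_def by blast
  let ?vY = "ext_vec Y v" and ?vX = "ext_vec X v" and ?vD = "ext_vec (X - Y) v"
  have finX: "finite X" by (rule closed_finite[OF X(1)])
  have uvv: "ext_mult (ext_mult u ?vY) ?vY = 0"
    unfolding ext_mult_assoc ext_vec_square[OF closed_finite[OF Y(1)]] zero_fun_def[symmetric]
    by (rule ext_mult_zero_right)
  have 1: "ext_mult w ?vY - ext_mult n ?vY \<in> os_span"
    using os_span_mult_vec[OF un(4) Y(5), of v]
    unfolding ext_mult_diff_left ext_mult_add_left uvv by simp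
  have vX: "ext_mult n ?vX = ext_mult n ?vY + ext_mult n ?vD"
    unfolding ext_vec_split[OF finX Y(4), of v] ext_mult_add_right ..
  \<comment> \<open>Modulo the ideal, e_S = n v_Y = n v_X - n v_(X - Y): the first term is the
    coboundary and the second lies in N.\<close>
  show ?thesis
  proof (rule liftableI)
    show "homog X (int q - 1) n" using un(2) Y(4) unfolding homog_def by blast
    have "homog X (int q - 1 + 1) (ext_mult n ?vD)"
      by (rule homog_mult_vec[OF un(2) Y(4) _ finX]) blast
    then have "homog X (int q) (ext_mult n ?vD)" by simp
    then show "homog X (int q) (- ext_mult n ?vD)" by (rule homog_uminus)
    have "avoids i (ext_mult n ?vD)"
      by (rule mult_vec_outside_avoids[OF Y(1,2) un(2,3)]) (use closed_subset_ground[OF X(1)] in auto)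
    then show "avoids i (- ext_mult n ?vD)" by (rule avoids_uminus)
    have "ext_basis S - (ext_mult n ?vX + - ext_mult n ?vD) =
        (ext_basis S - ext_mult w ?vY) + (ext_mult w ?vY - ext_mult n ?vY)"
      unfolding vX by simp
    then show "ext_basis S - (ext_mult n ?vX + - ext_mult n ?vD) \<in> os_span"
      using os_span_add[OF w(2) 1] by (simp only:)
  qed
qed

text \<open>Monomial by monomial: dependent ones are in the ideal, those whose closure misses
  \<open>i\<close> are in N, the others come from the preceding lemma. The flat varies in the
  induction because that lemma descends to smaller flats.\<close>

lemma homog_liftable:
  assumes "q \<le> p" "cl X = X" "i \<in> X" "homog X (int q) w"
  shows "liftable i v X (int q) w"
  using assms
proof (induction q arbitrary: X w)
  case (0 X w)
  show ?case
  proof (rule liftableI[OF homog_zero 0(4)])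
    \<comment> \<open>In degree 0 only the empty monomial occurs, and its closure is empty without
      loops, so \<open>w\<close> is already in N.\<close>
    have "S = {}" if "w S \<noteq> 0" for S
      using 0(4) that finite_subset[OF _ closed_finite[OF 0(2)]] by (auto simp: homog_def)
    then show "avoids i w" using cl_empty by (auto simp: avoids_def)
    show "w - (ext_mult 0 (ext_vec X v) + w) \<in> os_span" by (simp add: os_span.zero)
  qed
next
  case (Suc q X w)
  have IH: "liftable i v Y (int (Suc q) - 1) w'" if "cl Y = Y" "i \<in> Y" "homog Y (int (Suc q) - 1) w'" for Y w'
    using Suc.IH[of Y w'] that Suc.prems(1) by simp
  have basis: "liftable i v X (int (Suc q)) (ext_basis S)" if S: "S \<subseteq> X" "card S = Suc q" for S
  proof (cases "indep S")
    case False
    have "S \<subseteq> ground" using S(1) closed_subset_ground[OF Suc.prems(2)] by (rule subset_trans)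
    then have "ext_basis S - (ext_mult 0 (ext_vec X v) + 0) \<in> os_span"
      using os_span_dependent_basis[OF _ False, where 'k = 'k] by simp
    then show ?thesis by (rule liftableI[OF homog_zero homog_zero avoids_zero])
  next
    case ind: True
    show ?thesis
    proof (cases "i \<in> cl S")
      case True
      show ?thesis
        by (rule liftable_basis_spanning[OF IH Suc.prems(2,3) ind S True Suc.prems(1)])
    next
      case False
      show ?thesis
      proof (rule liftableI[OF homog_zero])
        show "homog X (int (Suc q)) (ext_basis S :: 'i set \<Rightarrow> 'k)" using S by (simp add: homog_def ext_basis_def)
        show "avoids i (ext_basis S :: 'i set \<Rightarrow> 'k)" using False by (simp add: avoids_def ext_basis_def)
        show "ext_basis S - (ext_mult 0 (ext_vec X v) + ext_basis S) \<in> os_span" by (simp add: os_span.zero)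
      qed
    qed
  qed
  have "liftable i v X (int (Suc q)) (scl (w A) (ext_basis A))" if "A \<in> Pow X" for A
  proof (cases "w A = 0")
    case True
    then have eq: "scl (w A) (ext_basis A) = 0" by (intro ext) simp
    show ?thesis unfolding eq by (rule liftable_zero)
  next
    case False
    then have "A \<subseteq> X" "card A = Suc q" using Suc.prems(4) by (auto simp: homog_def)
    then show ?thesis by (intro liftable_scl basis)
  qed
  then have "liftable i v X (int (Suc q)) (\<Sum>A\<in>Pow X. scl (w A) (ext_basis A))" by (rule liftable_sum)
  moreover have "w = (\<Sum>A\<in>Pow X. scl (w A) (ext_basis A))"
    by (rule ext_basis_expand[OF closed_finite[OF Suc.prems(2)]]) (use Suc.prems(4) in \<open>simp add: homog_def\<close>)
  ultimately show ?case by (simp only:)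
qed

text \<open>Over each relevant flat \<open>Y\<close> the element is a cocycle, hence exact;
  surjectivity lets its primitive be taken in N, and that primitive satisfies the same hypothesis
  one degree lower.\<close>

lemma avoiding_injective:
  assumes "q \<le> p" "homog ground (int q) n" "avoids i n"
    "cl_part (\<lambda>Z. i \<in> Z) (ext_mult n (ext_vec ground v)) \<in> os_span"
  shows "n \<in> os_span"
  using assms
proof (induction q arbitrary: n rule: nat_less_induct)
  case (1 q n)
  note prems = 1(2-5)
  let ?P = "cl_part (\<lambda>Z. i \<in> Z)" and ?v = "ext_vec ground v"
  have supp: "\<And>S. n S \<noteq> 0 \<Longrightarrow> S \<subseteq> ground" using prems(2) by (simp add: homog_def)
  show ?case
  proof (rule os_span_if_local[OF supp])
    fix S assume S: "n S \<noteq> 0" "indep S"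
    \<comment> \<open>The least flat containing \<open>S\<close> and \<open>i\<close>. Since
      \<open>i\<close> is outside the closure of \<open>S\<close>, its rank is q + 1, which
      \<open>nonres\<close> still covers up to q = p.\<close>
    define Y where "Y = cl (insert i S)"
    let ?vY = "ext_vec Y v" and ?nY = "cl_part (\<lambda>Z. Z \<subseteq> Y) n"
    have Sg: "S \<subseteq> ground" "insert i S \<subseteq> ground" using supp[OF S(1)] i by auto
    have Y: "cl Y = Y" "i \<in> Y" "S \<subseteq> Y" "Y \<subseteq> ground"
      unfolding Y_def using cl_idem[OF Sg(2)] cl_extensive[OF Sg(2)] cl_subset_ground by auto
    have "card S = q" using prems(2) S(1) by (auto simp: homog_def)
    moreover have "i \<notin> cl S" using prems(3) S(1) by (simp add: avoids_def)
    ultimately have rkY: "rk Y = Suc q"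
      unfolding Y_def using rk_cl[OF Sg(2)] rk_insert_notin_cl[OF i] rk_eq_card_indep[OF S(2)] by simp
    have hY: "homog Y (int q) ?nY"
      unfolding homog_def
    proof (intro allI impI)
      fix T assume "?nY T \<noteq> 0"
      then have T: "n T \<noteq> 0" "cl T \<subseteq> Y" by (simp_all add: cl_part_def split: if_splits)
      then show "T \<subseteq> Y \<and> int (card T) = q"
        using prems(2) subset_closed_iff[OF supp[OF T(1)] Y(1)] by (simp add: homog_def)
    qed
    have loc: "ext_mult ?nY ?vY = cl_part (\<lambda>Z. Z \<subseteq> Y) (ext_mult n ?v)"
      by (rule cl_part_mult_vec_ground[OF Y(1) supp, symmetric])
    have "?P (ext_mult ?nY ?vY) = cl_part (\<lambda>Z. Z \<subseteq> Y) (?P (ext_mult n ?v))"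
      unfolding loc by (rule cl_part_commute)
    then have P: "?P (ext_mult ?nY ?vY) \<in> os_span" using os_span_cl_part[OF prems(4)] by (simp only:)
    \<comment> \<open>The product has degree q + 1, the rank of \<open>Y\<close>; an independent
      monomial of this degree spans \<open>Y\<close> and so has \<open>i\<close> in its
      closure.\<close>
    have "cl_part (\<lambda>Z. i \<notin> Z) (ext_mult ?nY ?vY) \<in> os_span"
    proof (rule os_span_if_dependent_support)
      fix U assume "cl_part (\<lambda>Z. i \<notin> Z) (ext_mult ?nY ?vY) U \<noteq> 0"
      then have "ext_mult ?nY ?vY U \<noteq> 0" and U: "i \<notin> cl U" by (simp_all add: cl_part_def split: if_splits)
      then have "U \<subseteq> Y" "card U = Suc q"
        using homog_mult_vec_same[OF Y(1) hY, of v] unfolding homog_def by fastforce+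
      then show "U \<subseteq> ground \<and> \<not> indep U"
        using cl_indep_in_closed[of U Y] Y(1,2,4) rkY U by auto
    qed
    moreover have "ext_mult ?nY ?vY = ?P (ext_mult ?nY ?vY) + cl_part (\<lambda>Z. i \<notin> Z) (ext_mult ?nY ?vY)"
      by (rule ext) (simp add: cl_part_def)
    ultimately have coc: "ext_mult ?nY ?vY \<in> os_span" using os_span_add[OF P] by metis
    obtain w where w: "homog Y (int q - 1) w" "?nY - ext_mult w ?vY \<in> os_span"
      using local_homotopy[OF Y(1,2) _ hY coc] rkY prems(1) by auto
    have "?nY \<in> os_span"
    proof (cases q)
      case 0
      \<comment> \<open>The primitive has degree -1 here, so exactness already means vanishing
        modulo the ideal.\<close>
      have "w = 0"
      proof
        fix T show "w T = 0 T" using w(1) 0 by (auto simp: homog_def)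
      qed
      then show ?thesis using w(2) by simp
    next
      case (Suc q')
      have q': "int q - 1 = int q'" "q' \<le> p" using Suc prems(1) by auto
      obtain u n' where un: "homog Y (int q' - 1) u" "homog Y (int q') n'" "avoids i n'"
        "w - (ext_mult u ?vY + n') \<in> os_span"
        using homog_liftable[OF q'(2) Y(1,2) w(1)[unfolded q'(1)]] unfolding liftable_def by blast
      have uvv: "ext_mult (ext_mult u ?vY) ?vY = 0"
        unfolding ext_mult_assoc ext_vec_square[OF closed_finite[OF Y(1)]] zero_fun_def[symmetric]
        by (rule ext_mult_zero_right)
      have "ext_mult w ?vY - ext_mult n' ?vY \<in> os_span"
        using os_span_mult_vec[OF un(4) Y(4), of v]
        unfolding ext_mult_diff_left ext_mult_add_left uvv by simp
      from os_span_add[OF w(2) this] have nn': "?nY - ext_mult n' ?vY \<in> os_span" by simp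
      \<comment> \<open>As \<open>?nY\<close> lies in N, its P-component is zero, which forces the
        P-component of n' v_Y into the ideal.\<close>
      have "avoids i ?nY" using prems(3) by (simp add: avoids_def cl_part_def)
      then have "?P (?nY - ext_mult n' ?vY) = - ?P (ext_mult n' ?vY)"
        unfolding cl_part_diff by (simp add: cl_part_avoids)
      then have "- ?P (ext_mult n' ?vY) \<in> os_span" using os_span_cl_part[OF nn', of "\<lambda>Z. i \<in> Z"] by (simp only:)
      from os_span_uminus[OF this] have Pn': "?P (ext_mult n' ?vY) \<in> os_span" by simp
      \<comment> \<open>Passing from v_Y to v changes only the N-component, so the induction
        hypothesis on the whole ground set applies to \<open>n'\<close>.\<close>
      have "avoids i (ext_mult n' (ext_vec (ground - Y) v))"
        by (rule mult_vec_outside_avoids[OF Y(1,2) un(2,3)]) auto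
      then have "?P (ext_mult n' ?v) = ?P (ext_mult n' ?vY)"
        unfolding ext_vec_split[OF finite_ground Y(4), of v] ext_mult_add_right cl_part_add
        by (simp add: cl_part_avoids)
      then have Pn: "?P (ext_mult n' ?v) \<in> os_span" using Pn' by (simp only:)
      have "homog ground (int q') n'" using un(2) Y(4) unfolding homog_def by blast
      then have "n' \<in> os_span" using 1(1) Suc q'(2) un(3) Pn by blast
      from os_span_add[OF nn' os_span_mult_vec[OF this Y(4), of v]] show ?thesis by simp
    qed
    then show "\<exists>Y. cl Y = Y \<and> S \<subseteq> Y \<and> cl_part (\<lambda>Z. Z \<subseteq> Y) n \<in> os_span" using Y by blast
  qed
qed

text \<open>Write z = u v + n with n in N; then n v is in the ideal along with z v, and injectivity
  removes n.\<close>

lemma nonresonant_exact: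
  assumes z: "homog ground (int p) z" "ext_mult z (ext_vec ground v) \<in> os_span"
  shows "\<exists>u. homog ground (int p - 1) u \<and> z - ext_mult u (ext_vec ground v) \<in> os_span"
proof -
  let ?v = "ext_vec ground v"
  obtain u n where un: "homog ground (int p - 1) u" "homog ground (int p) n" "avoids i n"
    "z - (ext_mult u ?v + n) \<in> os_span"
    using homog_liftable[OF order_refl ground_closed i z(1)] unfolding liftable_def by blast
  have uvv: "ext_mult (ext_mult u ?v) ?v = 0"
    unfolding ext_mult_assoc ext_vec_square[OF finite_ground] zero_fun_def[symmetric]
    by (rule ext_mult_zero_right)
  have "ext_mult z ?v - ext_mult n ?v \<in> os_span"
    using os_span_mult_vec[OF un(4) order_refl, of v]
    unfolding ext_mult_diff_left ext_mult_add_left uvv by simp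
  from os_span_diff[OF z(2) this] have "ext_mult n ?v \<in> os_span" by simp
  then have "n \<in> os_span"
    using avoiding_injective[OF order_refl un(2,3)] os_span_cl_part by blast
  from os_span_add[OF un(4) this] have "z - ext_mult u ?v \<in> os_span" by simp
  then show ?thesis using un(1) by blast
qed

end

section \<open>From cohomology to covers\<close>

lemma exact_if_sum_nonzero:
  assumes "(\<Sum>j\<in>ground. v j) \<noteq> 0" "homog ground q z" "ext_mult z (ext_vec ground v) \<in> os_span"
  shows "\<exists>u. homog ground (q - 1) u \<and> z - ext_mult u (ext_vec ground v) \<in> os_span"
  \<comment> \<open>With \<open>K\<close> and \<open>X\<close> both the ground set, every circuit
    lies in \<open>K\<close>.\<close>
  by (rule homotopy[OF ground_closed order_refl _ assms]) simp

text \<open>Translates the quotient group into representatives in the exterior algebra: if all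
  representatives of cocycles were exact, the group would have a single coset.\<close>

lemma resonance_not_exact:
  fixes v :: "'i \<Rightarrow> 'k::field"
  assumes "v \<in> resonance p ground indep"
  shows "\<exists>z. homog ground (int p) z \<and> ext_mult z (ext_vec ground v) \<in> os_span \<and>
    \<not> (\<exists>u. homog ground (int p - 1) u \<and> z - ext_mult u (ext_vec ground v) \<in> os_span)"
proof (rule ccontr)
  assume "\<not> ?thesis"
  then have exact: "\<exists>u. homog ground (int p - 1) u \<and> z - ext_mult u (ext_vec ground v) \<in> os_span"
    if "homog ground (int p) z" "ext_mult z (ext_vec ground v) \<in> os_span" for z
    using that by blast
  let ?E = "ext_alg ground :: ('i set \<Rightarrow> 'k) ring" and ?vec = "ext_vec ground v"
  let ?A = "OS_alg ground indep :: ('i set \<Rightarrow> 'k) set ring"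
  let ?\<phi> = "OS_class ground indep :: ('i set \<Rightarrow> 'k) \<Rightarrow> ('i set \<Rightarrow> 'k) set"
  let ?Z = "OS_cocycles ground indep v p" and ?H = "OS_coboundaries ground indep v p"
  let ?G = "add_monoid ?A\<lparr>carrier := ?Z\<rparr>"
  interpret E: ring ?E by (rule ext_alg_ring[OF finite_ground])
  have car: "x \<in> carrier ?E \<longleftrightarrow> (\<forall>S. x S \<noteq> 0 \<longrightarrow> S \<subseteq> ground)" for x :: "'i set \<Rightarrow> 'k"
    by (simp add: ext_alg_def)
  have ops: "x \<oplus>\<^bsub>?E\<^esub> y = x + y" "x \<otimes>\<^bsub>?E\<^esub> y = ext_mult x y" "\<zero>\<^bsub>?E\<^esub> = 0" for x y
    by (auto simp: ext_alg_def)
  have gen: "{ext_deriv ground (ext_basis C) | C. circ C} \<subseteq> carrier ?E"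
  proof
    fix x :: "'i set \<Rightarrow> 'k" assume "x \<in> {ext_deriv ground (ext_basis C) | C. circ C}"
    then have "x \<in> os_span" using os_span_deriv_basis by blast
    then show "x \<in> carrier ?E" unfolding car using os_span_support[of x] by simp
  qed
  interpret I: ideal "OS_ideal ground indep" ?E
    unfolding OS_ideal_def by (rule E.genideal_ideal[OF gen])
  interpret A: ring ?A unfolding OS_alg_def by (rule I.quotient_is_ring)
  interpret \<phi>: ring_hom_ring ?E ?A ?\<phi>
    unfolding OS_alg_def OS_class_def by (rule I.rcos_ring_hom_ring)
  have hom_car: "x \<in> carrier ?E" if "homog ground q x" for x q
    using that by (simp add: homog_def car)
  have vec_car: "?vec \<in> carrier ?E" using ext_vec_support by (fastforce simp: car)
  have deg: "ext_degree ground q = {x :: 'i set \<Rightarrow> 'k. homog ground (int q) x}" for q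
    by (auto simp: ext_degree_def homog_def car)
  have diff: "OS_diff ground indep v (?\<phi> x) = ?\<phi> (ext_mult x ?vec)" if "x \<in> carrier ?E" for x
    unfolding OS_diff_def using \<phi>.hom_mult[OF that vec_car] by (simp add: ops)
  have zero_A: "\<zero>\<^bsub>?A\<^esub> = OS_ideal ground indep" by (simp add: OS_alg_def FactRing_def)
  have ker: "?\<phi> x = \<zero>\<^bsub>?A\<^esub> \<longleftrightarrow> x \<in> os_span" if "x \<in> carrier ?E" for x
  proof
    assume "?\<phi> x = \<zero>\<^bsub>?A\<^esub>"
    then have "OS_ideal ground indep +>\<^bsub>?E\<^esub> x = OS_ideal ground indep"
      unfolding zero_A OS_class_def .
    from E.a_coset_join1[OF this that I.a_subgroup] show "x \<in> os_span" unfolding OS_ideal_eq_span .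
  next
    assume "x \<in> os_span"
    then have x: "x \<in> OS_ideal ground indep" unfolding OS_ideal_eq_span .
    show "?\<phi> x = \<zero>\<^bsub>?A\<^esub>"
      unfolding zero_A OS_class_def by (rule E.a_coset_join2[OF that I.a_subgroup x])
  qed
  \<comment> \<open>The degree \<open>int p - 1\<close> unifies the two cases: for p = 0 it is -1,
    where only 0 is homogeneous.\<close>
  have H: "?H = {?\<phi> (ext_mult u ?vec) | u. homog ground (int p - 1) u}"
  proof (cases p)
    case 0
    have h: "homog ground (int p - 1) u \<longleftrightarrow> u = 0" for u :: "'i set \<Rightarrow> 'k"
      by (auto simp: homog_def 0 fun_eq_iff)
    have "{?\<phi> (ext_mult u ?vec) | u. homog ground (int p - 1) u} = {?\<phi> 0}"
      unfolding h by simp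
    also have "?\<phi> 0 = \<zero>\<^bsub>?A\<^esub>" using \<phi>.hom_zero unfolding ops .
    finally show ?thesis by (simp add: OS_coboundaries_def 0)
  next
    case (Suc q)
    have "?H = (\<lambda>u. OS_diff ground indep v (?\<phi> u)) ` {u. homog ground (int q) u}"
      by (simp add: OS_coboundaries_def Suc OS_degree_def deg image_image)
    also have "\<dots> = (\<lambda>u. ?\<phi> (ext_mult u ?vec)) ` {u. homog ground (int q) u}"
      by (rule image_cong) (use diff hom_car in auto)
    finally show ?thesis using Suc by (auto simp: image_def)
  qed
  have mult_car: "ext_mult u ?vec \<in> carrier ?E" if "homog ground q u" for u q
    using E.m_closed[OF hom_car[OF that] vec_car] unfolding ops .
  have sub: "subgroup ?H (add_monoid ?A)"
  proof (rule group.subgroupI)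
    show "group (add_monoid ?A)" by (rule A.a_group)
    show "?H \<subseteq> carrier (add_monoid ?A)" unfolding H using \<phi>.hom_closed[OF mult_car] by auto
    show "?H \<noteq> {}" unfolding H using homog_zero by blast
    fix a b assume a: "a \<in> ?H" and "b \<in> ?H"
    then obtain u u' where u: "homog ground (int p - 1) u" "a = ?\<phi> (ext_mult u ?vec)"
      "homog ground (int p - 1) u'" "b = ?\<phi> (ext_mult u' ?vec)" unfolding H by blast
    have "a \<oplus>\<^bsub>?A\<^esub> b = ?\<phi> (ext_mult (u + u') ?vec)"
      using \<phi>.hom_add[OF mult_car[OF u(1)] mult_car[OF u(3)]] u(2,4)
      by (simp add: ops ext_mult_add_left)
    then show "a \<otimes>\<^bsub>add_monoid ?A\<^esub> b \<in> ?H"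
      unfolding H using homog_add[OF u(1,3)] by auto
  next
    fix a assume "a \<in> ?H"
    then obtain u where u: "homog ground (int p - 1) u" "a = ?\<phi> (ext_mult u ?vec)" unfolding H by blast
    let ?b = "?\<phi> (ext_mult (- u) ?vec)"
    have "ext_mult (- u) ?vec + ext_mult u ?vec = 0"
      unfolding ext_mult_add_left[symmetric] by simp
    then have "?b \<oplus>\<^bsub>?A\<^esub> a = \<zero>\<^bsub>?A\<^esub>"
      using \<phi>.hom_add[OF mult_car[OF homog_uminus[OF u(1)]] mult_car[OF u(1)]] \<phi>.hom_zero u(2)
      unfolding ops by simp
    then have "\<ominus>\<^bsub>?A\<^esub> a = ?b"
      using \<phi>.hom_closed[OF mult_car] homog_uminus[OF u(1)] u by (intro A.minus_equality) auto
    then show "inv\<^bsub>add_monoid ?A\<^esub> a \<in> ?H"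
      unfolding H a_inv_def using homog_uminus[OF u(1)] by auto
  qed
  have Z: "?Z \<subseteq> ?H"
  proof
    fix a assume "a \<in> ?Z"
    then obtain x where x: "homog ground (int p) x" "a = ?\<phi> x" "OS_diff ground indep v a = \<zero>\<^bsub>?A\<^esub>"
      by (auto simp: OS_cocycles_def OS_degree_def deg)
    have "ext_mult x ?vec \<in> os_span"
      using x(3) ker[OF mult_car[OF x(1)]] diff[OF hom_car[OF x(1)]] x(2) by simp
    then obtain u where u: "homog ground (int p - 1) u" "x - ext_mult u ?vec \<in> os_span"
      using exact[OF x(1)] by blast
    have d: "x - ext_mult u ?vec \<in> carrier ?E" using os_span_support[OF u(2)] by (simp add: car)
    have "a = ?\<phi> (x - ext_mult u ?vec) \<oplus>\<^bsub>?A\<^esub> ?\<phi> (ext_mult u ?vec)"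
      using \<phi>.hom_add[OF d mult_car[OF u(1)]] x(2) unfolding ops by simp
    also have "\<dots> = ?\<phi> (ext_mult u ?vec)"
      using ker[OF d] u(2) \<phi>.hom_closed[OF mult_car[OF u(1)]] by simp
    finally show "a \<in> ?H" unfolding H using u(1) by blast
  qed
  have coset: "?H #>\<^bsub>?G\<^esub> a = ?H" if "a \<in> ?Z" for a
  proof -
    have "a \<in> ?H" using that Z by blast
    then have "?H #>\<^bsub>add_monoid ?A\<^esub> a = ?H"
      using group.coset_join2[OF A.a_group _ sub] subgroup.mem_carrier[OF sub] by blast
    \<comment> \<open>Cosets depend on the operation alone, so shrinking the carrier to the cocycles
      leaves them unchanged.\<close>
    then show ?thesis by (simp add: r_coset_def)
  qed
  \<comment> \<open>Some cocycle must exist, since otherwise the set of cosets would be empty rather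
    than a singleton.\<close>
  have "\<zero>\<^bsub>?A\<^esub> \<in> ?Z"
  proof -
    have "?\<phi> 0 = \<zero>\<^bsub>?A\<^esub>" using \<phi>.hom_zero unfolding ops .
    moreover have "OS_diff ground indep v (?\<phi> 0) = \<zero>\<^bsub>?A\<^esub>"
      using diff[of 0] calculation by (simp add: car)
    ultimately show ?thesis
      unfolding OS_cocycles_def OS_degree_def deg using homog_zero by (metis (mono_tags) image_eqI mem_Collect_eq)
  qed
  then have "carrier (OS_cohomology ground indep v p) = {\<one>\<^bsub>OS_cohomology ground indep v p\<^esub>}"
    using coset by (auto simp: OS_cohomology_def FactGroup_def RCOSETS_def)
  then show False using assms by (simp add: resonance_def)
qed

lemma resonance_subset_B_set:
  "(resonance p ground indep :: ('i \<Rightarrow> 'k::field) set) \<subseteq> B_set p ground indep"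
proof
  fix v :: "'i \<Rightarrow> 'k" assume v: "v \<in> resonance p ground indep"
  then obtain z where z: "homog ground (int p) z" "ext_mult z (ext_vec ground v) \<in> os_span"
    and not_exact: "\<not> (\<exists>u. homog ground (int p - 1) u \<and> z - ext_mult u (ext_vec ground v) \<in> os_span)"
    using resonance_not_exact by blast
  have "v \<in> V_space ground" using v by (simp add: resonance_def)
  moreover have "(\<Sum>j\<in>ground. v j) = 0"
    using exact_if_sum_nonzero[OF _ z] not_exact by blast
  ultimately have bar: "v \<in> V_bar ground" by (simp add: V_bar_def)
  \<comment> \<open>If this failed for \<open>i\<close>, no component of a small flat through
    \<open>i\<close> could have sum 0, and \<open>nonresonant_exact\<close> would make
    \<open>z\<close> exact. Choosing one such flat for each \<open>i\<close> gives the
    cover.\<close>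
  have "\<exists>X\<in>L_irr_le (p + 1) ground indep. i \<in> X \<and> (\<Sum>j\<in>X. v j) = 0" if i: "i \<in> ground" for i
  proof (rule ccontr)
    assume none: "\<not> ?thesis"
    have "(\<Sum>j\<in>component Y i. v j) \<noteq> 0" if "cl Y = Y" "i \<in> Y" "rk Y \<le> Suc p" for Y
      using none component_in_L_irr_le[OF that loopless] by (auto simp: component_def)
    from nonresonant_exact[OF i this z] not_exact show False by blast
  qed
  then obtain g where g: "\<And>i. i \<in> ground \<Longrightarrow>
      g i \<in> L_irr_le (p + 1) ground indep \<and> i \<in> g i \<and> (\<Sum>j\<in>g i. v j) = 0"
    by metis
  have "covers ground (g ` ground)" unfolding covers_def using g by blast
  moreover have "g ` ground \<subseteq> L_irr_le (p + 1) ground indep" using g by blast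
  moreover have "v \<in> P_cover ground (g ` ground)" using bar g by (auto simp: P_cover_def)
  ultimately show "v \<in> B_set p ground indep" unfolding B_set_def by blast
qed

end

theorem theorem3p14:
  fixes n :: nat and indep :: "nat set \<Rightarrow> bool"
    and scale :: "complex \<Rightarrow> 'w \<Rightarrow> 'w::ab_group_add"
  assumes "matroid {1..n} indep"
    and "complex_realizable scale {1..n} indep"
  shows "\<forall>p. (resonance p {1..n} indep :: (nat \<Rightarrow> 'k::field) set) \<subseteq> B_set p {1..n} indep"
proof -
  \<comment> \<open>The realizing forms are nonzero, so each one alone is linearly independent: the
    matroid has no loops.\<close>
  have "indep {x}" if "x \<in> {1..n}" for x
  proof -
    obtain f :: "nat \<Rightarrow> 'w \<Rightarrow> complex" where f: "\<forall>i\<in>{1..n}. \<exists>w. f i w \<noteq> 0"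
      "\<forall>S\<subseteq>{1..n}. \<not> indep S \<longleftrightarrow> linearly_dependent_family f S"
      using assms(2) unfolding complex_realizable_def by blast
    have "\<not> linearly_dependent_family f {x}"
      using f(1) that by (auto simp: linearly_dependent_family_def)
    then show ?thesis using f(2) that by blast
  qed
  then interpret loopless_matroid "{1..n}" indep
    using assms(1) by (simp add: loopless_matroid_def loopless_matroid_axioms_def)
  show ?thesis using resonance_subset_B_set by blast
qed

end
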